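(* Let $X\in\mathfrak{sl}(n,\mathbb{H})$ be an arbitrary non-zero $\mathrm{Ad}_{\mathrm{SL}(n,\mathbb{H})}$-real element. Then the following statements are equivalent. (1) $X$ is strongly $\mathrm{Ad}_{\mathrm{SL}(n,\mathbb{H})}$-real. (2) For every non-zero purely imaginary complex representative $\mu$ of an eigenvalue class of $X$, with multiplicity $m_\mu$ and corresponding partition $\mathbf{d}(m_\mu)=[d_1^{t_{d_1}},\dots,d_s^{t_{d_s}}]\in\mathcal{P}(m_\mu)$, the number $t_{d_\ell}$ is even for all $1\leq\ell\leq s$.
   Context: $\mathbb{H}=\mathbb{C}\oplus\mathbb{C}\mathbf{j}$ is the division ring of Hamilton's quaternions. Write $A\in\mathrm{M}(n,\mathbb{H})$ as $A=A_1+A_2\mathbf{j}$ with $A_1,A_2\in\mathrm{M}(n,\mathbb{C})$, and put $\Phi(A)=\begin{pmatrix}A_1&A_2\\-\overline{A_2}&\overline{A_1}\end{pmatrix}\in\mathrm{M}(2n,\mathbb{C})$. $\mathrm{SL}(n,\mathbb{H})$ consists of the $g\in\mathrm{GL}(n,\mathbb{H})$ with $\det\Phi(g)=1$, and $\mathfrak{sl}(n,\mathbb{H})$ of the $X\in\mathrm{M}(n,\mathbb{H})$ with $\mathrm{tr}\,\Phi(X)=0$. For a linear Lie group $G$ with Lie algebra $\mathfrak{g}$, $X\in\mathfrak{g}$ is $\mathrm{Ad}_G$-real if $-X=gXg^{-1}$ for some $g\in G$, and strongly $\mathrm{Ad}_G$-real if moreover $-X=gXg^{-1}$ for some involution $g\in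 G$ (an element with $g^2=\mathrm{I}$). Eigenvalues are right eigenvalues ($Xv=v\lambda$, $v\neq0$); they occur in similarity classes $[\lambda]=\{\mu^{-1}\lambda\mu:\mu\in\mathbb{H}\setminus\{0\}\}$, each containing a unique complex number with non-negative imaginary part, taken as its complex representative. Let $\mathrm{J}(m,\lambda)$ be the $m\times m$ Jordan block ($\lambda$ on the diagonal, $1$ on the superdiagonal, $0$ elsewhere). Every $X\in\mathrm{M}(n,\mathbb{H})$ is conjugate under $\mathrm{GL}(n,\mathbb{H})$ to a direct sum of blocks $\mathrm{J}(m,\lambda)$ with $\lambda\in\mathbb{C}$, $\mathrm{Im}\,\lambda\ge0$, unique up to permutation of blocks. The multiplicity of an eigenvalue class is the sum of the sizes of the Jordan blocks belonging to its representative, and its corresponding partition is the partition of the multiplicity given by these sizes. A partition of a positive integer $m$ is written $[d_1^{t_{d_1}},\dots,d_s^{t_{d_s}}]$ with $d_1>\cdots>d_s>0$, $t_{d_i}\geq1$, $\sum_i t_{d_i}d_i=m$ (so $t_{d_i}$ is the number of parts equal to $d_i$); $\mathcal{P}(m)$ is the set of partitions of $m$. *)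

theory Defs
  imports Complex_Main "HOL-Library.Multiset" "Jordan_Normal_Form.Jordan_Normal_Form"
begin

(* \<open>Quat a b\<close> is the quaternion \<open>a + b j\<close>; multiplication is determined by
   \<open>j z = cnj z j\<close> for complex z and \<open>j\<^sup>2 = -1\<close>. *)

datatype quat = Quat (c1: complex) (c2: complex)

lemma quat_eq_iff: "p = q \<longleftrightarrow> c1 p = c1 q \<and> c2 p = c2 q"
  by (cases p; cases q) auto

instantiation quat :: division_ring
begin

definition zero_quat :: quat where "0 = Quat 0 0"
definition one_quat :: quat where "1 = Quat 1 0"
definition plus_quat :: "quat \<Rightarrow> quat \<Rightarrow> quat" where
  "p + q = Quat (c1 p + c1 q) (c2 p + c2 q)"
definition uminus_quat :: "quat \<Rightarrow> quat" where
  "- q = Quat (- c1 q) (- c2 q)"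
definition minus_quat :: "quat \<Rightarrow> quat \<Rightarrow> quat" where
  "p - q = Quat (c1 p - c1 q) (c2 p - c2 q)"
definition times_quat :: "quat \<Rightarrow> quat \<Rightarrow> quat" where
  "p * q = Quat (c1 p * c1 q - c2 p * cnj (c2 q)) (c1 p * c2 q + c2 p * cnj (c1 q))"
definition inverse_quat :: "quat \<Rightarrow> quat" where
  "inverse q =
     (let N = complex_of_real ((cmod (c1 q))\<^sup>2 + (cmod (c2 q))\<^sup>2)
      in Quat (cnj (c1 q) / N) (- c2 q / N))"
definition divide_quat :: "quat \<Rightarrow> quat \<Rightarrow> quat" where
  "p div q = p * inverse (q :: quat)"

instance
proof
  fix q :: quat
  assume "q \<noteq> 0"
  then have "c1 q \<noteq> 0 \<or> c2 q \<noteq> 0"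
    by (auto simp: quat_eq_iff zero_quat_def)
  then have N: "(cmod (c1 q))\<^sup>2 + (cmod (c2 q))\<^sup>2 \<noteq> 0"
    by (simp add: sum_power2_eq_zero_iff)
  define N where "N = complex_of_real ((cmod (c1 q))\<^sup>2 + (cmod (c2 q))\<^sup>2)"
  have N0: "N \<noteq> 0" using N unfolding N_def of_real_eq_0_iff .
  have NE: "N = c1 q * cnj (c1 q) + c2 q * cnj (c2 q)"
    unfolding N_def by (simp only: of_real_add complex_norm_square)
  have cN: "cnj N = N" unfolding N_def by simp
  have inv: "inverse q = Quat (cnj (c1 q) / N) (- c2 q / N)"
    by (simp add: inverse_quat_def N_def Let_def)
  show "inverse q * q = 1"
    using N0 by (simp add: inv times_quat_def one_quat_def NE[symmetric] field_simps)
  show "q * inverse q = 1"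
    using N0 by (simp add: inv times_quat_def one_quat_def cN field_simps)
      (simp add: NE algebra_simps)
next
  show "inverse (0 :: quat) = 0"
    by (simp add: inverse_quat_def zero_quat_def)
qed (auto simp: quat_eq_iff zero_quat_def one_quat_def plus_quat_def uminus_quat_def
      minus_quat_def times_quat_def divide_quat_def algebra_simps)

end

definition quat_of_complex :: "complex \<Rightarrow> quat" where
  "quat_of_complex z = Quat z 0"

definition Phi :: "quat mat \<Rightarrow> complex mat" where
  "Phi A = four_block_mat
     (map_mat c1 A)                   (map_mat c2 A)
     (map_mat (\<lambda>q. - cnj (c2 q)) A)   (map_mat (\<lambda>q. cnj (c1 q)) A)"

definition mat_trace :: "'a :: comm_monoid_add mat \<Rightarrow> 'a" where
  "mat_trace A = (\<Sum>i<dim_row A. A $$ (i, i))"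

definition GL_quat :: "nat \<Rightarrow> quat mat set" where
  "GL_quat n = {g \<in> carrier_mat n n. invertible_mat g}"

definition SL_quat :: "nat \<Rightarrow> quat mat set" where
  "SL_quat n = {g \<in> GL_quat n. det (Phi g) = 1}"

definition sl_quat :: "nat \<Rightarrow> quat mat set" where
  "sl_quat n = {X \<in> carrier_mat n n. mat_trace (Phi X) = 0}"

(* The two inverts_mat conditions say that \<open>h\<close> is the (unique) two-sided inverse of \<open>g\<close>. *)

definition Ad_neg :: "'a :: ring_1 mat \<Rightarrow> 'a mat \<Rightarrow> bool" where
  "Ad_neg g X \<longleftrightarrow> (\<exists>h. inverts_mat g h \<and> inverts_mat h g \<and> - X = g * X * h)"

definition Ad_real :: "'a :: ring_1 mat set \<Rightarrow> 'a mat \<Rightarrow> bool" where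
  "Ad_real G X \<longleftrightarrow> (\<exists>g\<in>G. Ad_neg g X)"

definition strongly_Ad_real :: "'a :: ring_1 mat set \<Rightarrow> 'a mat \<Rightarrow> bool" where
  "strongly_Ad_real G X \<longleftrightarrow> (\<exists>g\<in>G. g * g = 1\<^sub>m (dim_row g) \<and> Ad_neg g X)"

definition right_eigenvalue :: "quat mat \<Rightarrow> quat \<Rightarrow> bool" where
  "right_eigenvalue X l \<longleftrightarrow>
     (\<exists>v \<in> carrier_vec (dim_col X). v \<noteq> 0\<^sub>v (dim_col X) \<and> X *\<^sub>v v = map_vec (\<lambda>x. x * l) v)"

definition similarity_class :: "quat \<Rightarrow> quat set" where
  "similarity_class l = {inverse u * l * u | u. u \<noteq> 0}"

definition eigenvalue_reps :: "quat mat \<Rightarrow> complex set" where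
  "eigenvalue_reps X =
     {\<mu>. Im \<mu> \<ge> 0 \<and> (\<exists>l. right_eigenvalue X l \<and> quat_of_complex \<mu> \<in> similarity_class l)}"

definition quat_jordan_form :: "quat mat \<Rightarrow> (nat \<times> complex) list \<Rightarrow> bool" where
  "quat_jordan_form X bs \<longleftrightarrow>
     (\<forall>(m, z) \<in> set bs. Im z \<ge> 0) \<and>
     jordan_nf X (map (\<lambda>(m, z). (m, quat_of_complex z)) bs)"

(* The Jordan form exists and is unique up to the order of the blocks, so the multiset of
   blocks \<open>(size, eigenvalue)\<close> does not depend on the choice. *)

definition jordan_blocks :: "quat mat \<Rightarrow> (nat \<times> complex) multiset" where
  "jordan_blocks X = mset (SOME bs. quat_jordan_form X bs)"

(* The partition is the multiset of its parts: \<open>t\<^sub>d\<close> is the count of \<open>d\<close>,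
   and the sum of the multiset is the multiplicity of the eigenvalue class. *)

definition eigen_partition :: "quat mat \<Rightarrow> complex \<Rightarrow> nat multiset" where
  "eigen_partition X \<mu> = image_mset fst {# b \<in># jordan_blocks X. snd b = \<mu> #}"

end

theory Submission
  imports Defs "Jordan_Normal_Form.Jordan_Normal_Form_Existence"
    "Jordan_Normal_Form.Jordan_Normal_Form_Uniqueness" "Jordan_Normal_Form.Spectral_Radius"
begin

text \<open>
Everything is transported to complex matrices by \<open>Phi\<close>. On \<open>\<complex>\<^sup>2\<^sup>n\<close> the antilinear map
\<open>v \<mapsto> J cnj(v)\<close>, with \<open>J = jmat n\<close>, has square \<open>-1\<close>, and a complex matrix \<open>R\<close> lies in the range of
\<open>Phi\<close> exactly when it commutes with this map, that is \<open>R J = J cnj(R)\<close>. Two principles follow.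

Descent (\<open>similar_mat_if_similar_mat_Phi\<close>): if \<open>Phi X\<close> and \<open>Phi Y\<close> are similar over \<open>\<complex>\<close>, then \<open>X\<close> and
\<open>Y\<close> are similar over the quaternions. An intertwiner \<open>P\<close> is averaged with its conjugate
\<open>P' = - J cnj(P) J\<close>: every \<open>a P + cnj(a) P'\<close> is an intertwiner in the range of \<open>Phi\<close>, and only finitely
many ratios \<open>a / cnj(a)\<close> make it singular.

Parity (\<open>even_kernel_dim\<close>): a complex space that carries an antilinear map of square \<open>-1\<close> has even
dimension, because \<open>C cnj(C) = -1\<close> forces \<open>|det C|\<^sup>2 = (-1)\<^sup>d\<close>. If such a map preserves all generalised
eigenspaces of \<open>M\<close> at \<open>z\<close>, then for every \<open>k\<close> the number of Jordan blocks of size \<open>k\<close> at \<open>z\<close>, a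
combination of their dimensions, is even (\<open>even_nr_of_jordan_blocks\<close>).

Existence of the quaternionic Jordan form comes out of both. The blocks of \<open>Phi X\<close> are symmetric
under conjugation, and those at real eigenvalues occur in even number by parity, so they are the
blocks of \<open>Phi\<close> of a quaternionic Jordan matrix \<open>Y\<close>; descent gives the similarity of \<open>X\<close> and \<open>Y\<close>. The
blocks \<open>bs\<close> of \<open>X\<close> and the blocks of \<open>Phi X\<close> determine each other: the latter are \<open>bs\<close> together with
its conjugate.

(1) implies (2): if \<open>g\<close> is an involution with \<open>X g = - g X\<close> and \<open>z\<close> is purely imaginary, then
\<open>v \<mapsto> Phi(g) J cnj(v)\<close> is antilinear, has square \<open>-1\<close> and preserves the generalised eigenspaces of
\<open>Phi X\<close> at \<open>z\<close>, since \<open>Phi(g)\<close> and \<open>J cnj\<close> both exchange \<open>z\<close> with \<open>-z = cnj(z)\<close>. Parity applies.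

(2) implies (1): since \<open>X\<close> is similar to \<open>-X\<close>, its block multiset is invariant under \<open>z \<mapsto> -cnj(z)\<close>, which
fixes precisely the purely imaginary \<open>z\<close>. With (2), the blocks with \<open>z \<noteq> 0\<close> split into pairs
\<open>J(m,z), J(m,-cnj(z))\<close>. As \<open>-cnj(z)\<close> and \<open>-z\<close> are similar quaternions, \<open>X\<close> is similar to \<open>diag(A, -A, N)\<close>
with \<open>A\<close> and \<open>N\<close> complex and \<open>N\<close> a nilpotent Jordan matrix. Exchanging the first two blocks, and
conjugating \<open>N\<close> by \<open>diag(1, -1, 1, ...)\<close>, is a real involution that negates this matrix, and a real
matrix \<open>g\<close> satisfies \<open>det (Phi g) = (det g)\<^sup>2\<close>, which is \<open>1\<close> for an involution.
\<close>

section \<open>Entrywise conjugation and block matrices\<close>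

interpretation cnj: field_hom cnj
  by unfold_locales auto

lemma map_mat_cnj_cnj [simp]: "map_mat cnj (map_mat cnj A) = A"
  by (rule eq_matI) auto

lemma cnj_uminus: "map_mat cnj (- A) = - map_mat cnj A"
  by (rule eq_matI) auto

lemma four_block_mat_inject:
  assumes "A \<in> carrier_mat r1 m1" "B \<in> carrier_mat r1 m2"
    "C \<in> carrier_mat r2 m1" "D \<in> carrier_mat r2 m2"
    and "A' \<in> carrier_mat r1 m1" "B' \<in> carrier_mat r1 m2"
    "C' \<in> carrier_mat r2 m1" "D' \<in> carrier_mat r2 m2"
    and eq: "four_block_mat A B C D = four_block_mat A' B' C' D'"
  shows "A = A'" "B = B'" "C = C'" "D = D'"
proof -
  have e: "four_block_mat A B C D $$ (i,j) = four_block_mat A' B' C' D' $$ (i,j)" for i j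
    using eq by simp
  show "A = A'"
  proof (rule eq_matI)
    fix i j assume "i < dim_row A'" "j < dim_col A'"
    then show "A $$ (i,j) = A' $$ (i,j)" using e[of i j] assms(1-8) by simp
  qed (use assms(1-8) in auto)
  show "B = B'"
  proof (rule eq_matI)
    fix i j assume "i < dim_row B'" "j < dim_col B'"
    then show "B $$ (i,j) = B' $$ (i,j)" using e[of i "j + m1"] assms(1-8) by simp
  qed (use assms(1-8) in auto)
  show "C = C'"
  proof (rule eq_matI)
    fix i j assume "i < dim_row C'" "j < dim_col C'"
    then show "C $$ (i,j) = C' $$ (i,j)" using e[of "i + r1" j] assms(1-8) by simp
  qed (use assms(1-8) in auto)
  show "D = D'"
  proof (rule eq_matI)
    fix i j assume "i < dim_row D'" "j < dim_col D'"
    then show "D $$ (i,j) = D' $$ (i,j)" using e[of "i + r1" "j + m1"] assms(1-8) by simp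
  qed (use assms(1-8) in auto)
qed

section \<open>The embedding of quaternionic matrices into complex matrices\<close>

lemma c1_simps [simp]: "c1 0 = 0" "c1 1 = 1" "c1 (p + q) = c1 p + c1 q" "c1 (- p) = - c1 p"
  "c1 (p * q) = c1 p * c1 q - c2 p * cnj (c2 q)"
  by (simp_all add: zero_quat_def one_quat_def plus_quat_def uminus_quat_def times_quat_def)

lemma c2_simps [simp]: "c2 0 = 0" "c2 1 = 0" "c2 (p + q) = c2 p + c2 q" "c2 (- p) = - c2 p"
  "c2 (p * q) = c1 p * c2 q + c2 p * cnj (c1 q)"
  by (simp_all add: zero_quat_def one_quat_def plus_quat_def uminus_quat_def times_quat_def)

lemma c1_sum: "c1 (\<Sum>i\<in>S. f i) = (\<Sum>i\<in>S. c1 (f i))"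
  by (induction S rule: infinite_finite_induct) auto

lemma c2_sum: "c2 (\<Sum>i\<in>S. f i) = (\<Sum>i\<in>S. c2 (f i))"
  by (induction S rule: infinite_finite_induct) auto

interpretation quat_of_complex: ring_hom quat_of_complex
  by unfold_locales (auto simp: quat_of_complex_def quat_eq_iff zero_quat_def one_quat_def plus_quat_def times_quat_def)

lemma Phi_carrier [simp]: "A \<in> carrier_mat n m \<Longrightarrow> Phi A \<in> carrier_mat (n + n) (m + m)"
  by (auto simp: Phi_def)

lemma Phi_dim [simp]: "dim_row (Phi A) = dim_row A + dim_row A" "dim_col (Phi A) = dim_col A + dim_col A"
  by (auto simp: Phi_def)

lemma Phi_mult:
  assumes A: "A \<in> carrier_mat n m" and B: "B \<in> carrier_mat m l"
  shows "Phi (A * B) = Phi A * Phi B"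
proof -
  have 1: "map_mat c1 (A * B) = map_mat c1 A * map_mat c1 B + map_mat c2 A * map_mat (\<lambda>q. - cnj (c2 q)) B"
    by (rule eq_matI) (use A B in \<open>simp_all add: scalar_prod_def c1_sum sum.distrib sum_negf sum_subtractf\<close>)
  have 2: "map_mat c2 (A * B) = map_mat c1 A * map_mat c2 B + map_mat c2 A * map_mat (\<lambda>q. cnj (c1 q)) B"
    by (rule eq_matI) (use A B in \<open>simp_all add: scalar_prod_def c2_sum sum.distrib\<close>)
  have 3: "map_mat (\<lambda>q. - cnj (c2 q)) (A * B)
      = map_mat (\<lambda>q. - cnj (c2 q)) A * map_mat c1 B + map_mat (\<lambda>q. cnj (c1 q)) A * map_mat (\<lambda>q. - cnj (c2 q)) B"
    by (rule eq_matI) (use A B in \<open>simp_all add: scalar_prod_def c2_sum sum.distrib sum_negf sum_subtractf\<close>)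
  have 4: "map_mat (\<lambda>q. cnj (c1 q)) (A * B)
      = map_mat (\<lambda>q. - cnj (c2 q)) A * map_mat c2 B + map_mat (\<lambda>q. cnj (c1 q)) A * map_mat (\<lambda>q. cnj (c1 q)) B"
    by (rule eq_matI) (use A B in \<open>simp_all add: scalar_prod_def c1_sum sum.distrib sum_negf sum_subtractf\<close>)
  show ?thesis
    unfolding Phi_def 1 2 3 4
    by (rule mult_four_block_mat[symmetric]) (use A B in auto)
qed

lemma Phi_one: "Phi (1\<^sub>m n) = 1\<^sub>m (n + n)"
  unfolding four_block_one_mat[symmetric, of n n] Phi_def
  by (auto intro!: cong_four_block_mat eq_matI)

lemma Phi_uminus: "Phi (- A) = - Phi A"
  unfolding Phi_def by (rule eq_matI) auto

lemma Phi_quat_of_complex: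
  assumes "A \<in> carrier_mat n n"
  shows "Phi (map_mat quat_of_complex A) = four_block_mat A (0\<^sub>m n n) (0\<^sub>m n n) (map_mat cnj A)"
  unfolding Phi_def using assms
  by (auto intro!: cong_four_block_mat eq_matI simp: quat_of_complex_def)

lemma Phi_inject:
  assumes "A \<in> carrier_mat n m" "B \<in> carrier_mat n m" "Phi A = Phi B"
  shows "A = B"
proof -
  have "map_mat c1 A = map_mat c1 B" "map_mat c2 A = map_mat c2 B"
    using four_block_mat_inject[OF _ _ _ _ _ _ _ _ assms(3)[unfolded Phi_def], of n m m n] assms(1,2)
    by auto
  then have 1: "map_mat c1 A $$ (i,j) = map_mat c1 B $$ (i,j)" 
    and 2: "map_mat c2 A $$ (i,j) = map_mat c2 B $$ (i,j)" for i j by auto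
  show ?thesis
  proof (rule eq_matI)
    fix i j assume "i < dim_row B" "j < dim_col B"
    then show "A $$ (i,j) = B $$ (i,j)" using 1[of i j] 2[of i j] assms(1,2)
      by (simp add: quat_eq_iff)
  qed (use assms(1,2) in auto)
qed

section \<open>The quaternionic structure\<close>

text \<open>Identify the quaternionic column \<open>a + b j\<close> with the complex column \<open>(a, - cnj(b))\<close>, as in the first half of
the columns of \<open>Phi\<close>. Right multiplication by \<open>j\<close> then becomes the antilinear map
\<open>v \<mapsto> jmat n * cnj(v)\<close>, which therefore squares to \<open>-1\<close> and commutes with every \<open>Phi A\<close> (lemma
\<open>Phi_jmat\<close>).\<close>

definition jmat :: "nat \<Rightarrow> complex mat" where
  "jmat n = four_block_mat (0\<^sub>m n n) (1\<^sub>m n) (- 1\<^sub>m n) (0\<^sub>m n n)"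

lemma jmat_carrier [simp]: "jmat n \<in> carrier_mat (n + n) (n + n)"
  by (simp add: jmat_def)

lemma cnj_jmat [simp]: "map_mat cnj (jmat n) = jmat n"
  unfolding jmat_def by (rule eq_matI) auto

lemma jmat_sq: "jmat n * jmat n = - 1\<^sub>m (n + n)"
  unfolding jmat_def four_block_one_mat[symmetric, of n n]
  by (subst mult_four_block_mat[of _ n n _ n _ n _ _ n _ n]) (auto intro!: eq_matI)

lemma jmat_jmat: "A \<in> carrier_mat (n + n) m \<Longrightarrow> jmat n * (jmat n * A) = - A"
  by (subst assoc_mult_mat[of _ "n+n" "n+n" _ "n+n" _ m, symmetric]) (auto simp: jmat_sq)

lemma jmat_inverse:
  "jmat n * - jmat n = 1\<^sub>m (n + n)" "- jmat n * jmat n = 1\<^sub>m (n + n)"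
  using jmat_carrier[of n] by (simp_all add: jmat_sq carrier_matD[OF jmat_carrier])

lemma four_block_mult_jmat:
  assumes "A \<in> carrier_mat n n" "B \<in> carrier_mat n n" "C \<in> carrier_mat n n" "D \<in> carrier_mat n n"
  shows "four_block_mat A B C D * jmat n = four_block_mat (- B) A (- D) C"
  unfolding jmat_def 
  by (subst mult_four_block_mat[of _ n n _ n _ n _ _ n _ n])
     (use assms in \<open>auto intro!: cong_four_block_mat\<close>)

lemma jmat_mult_four_block:
  assumes "A \<in> carrier_mat n n" "B \<in> carrier_mat n n" "C \<in> carrier_mat n n" "D \<in> carrier_mat n n"
  shows "jmat n * four_block_mat A B C D = four_block_mat C D (- A) (- B)"
  unfolding jmat_def 
  by (subst mult_four_block_mat[of _ n n _ n _ n _ _ n _ n])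
     (use assms in \<open>auto intro!: cong_four_block_mat\<close>)

lemma Phi_jmat:
  assumes A: "A \<in> carrier_mat n n"
  shows "Phi A * jmat n = jmat n * map_mat cnj (Phi A)"
proof -
  have c: "map_mat cnj (Phi A) = four_block_mat (map_mat (\<lambda>q. cnj (c1 q)) A) (map_mat (\<lambda>q. cnj (c2 q)) A)
     (map_mat (\<lambda>q. - c2 q) A) (map_mat c1 A)"
    unfolding Phi_def by (rule eq_matI) (use A in auto)
  show ?thesis
    unfolding c unfolding Phi_def using A
    by (subst four_block_mult_jmat) 
      (auto simp: jmat_mult_four_block[of _ n] intro!: cong_four_block_mat eq_matI)
qed

text \<open>Comparing blocks, \<open>R J = J cnj(R)\<close> says that the lower half of \<open>R\<close> is determined by the upper half in the
way that defines \<open>Phi\<close>; the upper half supplies the two complex components of \<open>Q\<close>.\<close>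

lemma Phi_preimage:
  assumes R: "R \<in> carrier_mat (n + n) (n + n)" and J: "R * jmat n = jmat n * map_mat cnj R"
  obtains Q where "Q \<in> carrier_mat n n" "R = Phi Q"
proof -
  obtain A B C D where s: "split_block R n n = (A, B, C, D)" by (metis prod_cases4)
  note sb = split_block[OF s, of n n]
  have car: "A \<in> carrier_mat n n" "B \<in> carrier_mat n n" "C \<in> carrier_mat n n" "D \<in> carrier_mat n n"
    and RE: "R = four_block_mat A B C D"
    using sb R by auto
  have cR: "map_mat cnj R = four_block_mat (map_mat cnj A) (map_mat cnj B) (map_mat cnj C) (map_mat cnj D)"
    unfolding RE by (rule eq_matI) (use car in auto)
  have eq: "four_block_mat (- B) A (- D) C
      = four_block_mat (map_mat cnj C) (map_mat cnj D) (- map_mat cnj A) (- map_mat cnj B)"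
    using J unfolding cR unfolding RE
    by (subst (asm) four_block_mult_jmat) (use car in \<open>auto simp: jmat_mult_four_block[of _ n]\<close>)
  have e: "A = map_mat cnj D" "C = - map_mat cnj B"
    using four_block_mat_inject[OF _ _ _ _ _ _ _ _ eq, of n n n n] car by auto
  have D: "D = map_mat cnj A" unfolding e by simp
  define Q where "Q = mat n n (\<lambda>ij. Quat (A $$ ij) (B $$ ij))"
  have "R = Phi Q"
    unfolding RE Phi_def e(2) D Q_def
    by (rule cong_four_block_mat) (use car in \<open>auto intro!: eq_matI\<close>)
  moreover have "Q \<in> carrier_mat n n" by (simp add: Q_def)
  ultimately show ?thesis using that by blast
qed

section \<open>Descent of similarity\<close>

lemma det_nonzero_imp_inverse:
  assumes "A \<in> carrier_mat n n" "det (A :: 'a :: field mat) \<noteq> 0"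
  obtains B where "B \<in> carrier_mat n n" "B * A = 1\<^sub>m n" "A * B = 1\<^sub>m n"
  using det_non_zero_imp_unit[OF assms, of "()"] unfolding Units_def ring_mat_def by auto

lemma similar_mat_Phi:
  assumes "similar_mat X Y"
  shows "similar_mat (Phi X) (Phi Y)"
proof -
  obtain n P Q where c: "{X,Y,P,Q} \<subseteq> carrier_mat n n" and 1: "P * Q = 1\<^sub>m n" "Q * P = 1\<^sub>m n" "X = P * Y * Q"
    using similar_matD[OF assms] by blast
  show ?thesis
  proof (rule similar_matI[of _ _ "Phi P" "Phi Q" "n + n"])
    show "Phi P * Phi Q = 1\<^sub>m (n + n)" "Phi Q * Phi P = 1\<^sub>m (n + n)"
      using c by (simp_all add: Phi_one 1 flip: Phi_mult[of _ n n _ n])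
    have "P * Y \<in> carrier_mat n n" using c by (intro mult_carrier_mat[of _ n n]) auto
    from Phi_mult[OF this, of Q n] show "Phi X = Phi P * Phi Y * Phi Q"
      using c by (simp add: 1(3) Phi_mult[of _ n n _ n])
  qed (use c in auto)
qed

text \<open>Up to the factors \<open>P\<close> and \<open>s - i\<close>, the combination is \<open>P\<inverse> P' + t\<close> with
\<open>t = (s + i) / (s - i)\<close>. It is singular only if \<open>-t\<close> is one of the finitely many eigenvalues of
\<open>P\<inverse> P'\<close>, while \<open>t\<close> takes infinitely many values.\<close>

lemma exists_nonsingular_combination:
  assumes P: "P \<in> carrier_mat N N" and P': "P' \<in> carrier_mat N N" and P1: "P1 \<in> carrier_mat N N"
    and PP1: "P * P1 = 1\<^sub>m N"
  shows "\<exists>s :: real. det (Complex s 1 \<cdot>\<^sub>m P + Complex s (-1) \<cdot>\<^sub>m P') \<noteq> (0 :: complex)"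
proof -
  define W where "W = P1 * P'"
  have W: "W \<in> carrier_mat N N" unfolding W_def using P1 P' by simp
  define t where "t = (\<lambda>s. - (Complex s 1 / Complex s (-1)))"
  have nz: "Complex s (-1) \<noteq> 0" "Complex s 1 \<noteq> 0" for s by (simp_all add: complex_eq_iff)
  have "inj t"
  proof (rule injI)
    fix x y assume "t x = t y"
    then have "Complex x 1 * Complex y (-1) = Complex y 1 * Complex x (-1)"
      unfolding t_def using nz by (simp add: divide_simps)
    then show "x = y" by (simp add: complex_eq_iff)
  qed
  then have "infinite (range t)" by (simp add: finite_image_iff infinite_UNIV_char_0)
  moreover have "finite (spectrum W)" by (rule card_finite_spectrum(1)[OF W])
  ultimately obtain s where s: "t s \<notin> spectrum W"
    by (meson finite_subset image_subsetI)
  then have d: "det (char_matrix W (t s)) \<noteq> 0"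
    using eigenvalue_det[OF W] by (simp add: spectrum_def)
  have PW: "P * W = P'"
    unfolding W_def using P P1 P' PP1 by (simp flip: assoc_mult_mat)
  have "Complex s 1 \<cdot>\<^sub>m P + Complex s (-1) \<cdot>\<^sub>m P' = Complex s (-1) \<cdot>\<^sub>m (P * char_matrix W (t s))"
  proof -
    have "P * char_matrix W (t s) = P' + (- t s) \<cdot>\<^sub>m P"
      unfolding char_matrix_def using W P PW
      by (subst mult_add_distrib_mat[of _ N N _ N]) (auto simp: mult_smult_distrib[of _ N N _ N])
    then show ?thesis
      using P P' nz[of s] by (intro eq_matI) (auto simp: t_def algebra_simps)
  qed
  moreover have "det P \<noteq> 0" using det_mult[OF P P1] PP1 by auto
  ultimately have "det (Complex s 1 \<cdot>\<^sub>m P + Complex s (-1) \<cdot>\<^sub>m P') \<noteq> 0"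
    using d nz[of s] P W by (simp add: det_mult[of _ N])
  then show ?thesis by blast
qed

text \<open>Given \<open>P\<close> with \<open>Phi X * P = P * Phi Y\<close>, its conjugate \<open>P' = - J cnj(P) J\<close> under the quaternionic
structure intertwines as well, and so do all combinations. The coefficients \<open>s + i\<close> and \<open>s - i\<close> are
conjugate to each other, so the combination is fixed by this conjugation and comes from a
quaternionic matrix; its inverse does too.\<close>

lemma similar_mat_if_similar_mat_Phi:
  assumes X: "X \<in> carrier_mat n n" and Y: "Y \<in> carrier_mat n n"
    and sim: "similar_mat (Phi X) (Phi Y)"
  shows "similar_mat X Y"
proof -
  define N where "N = n + n"
  define J where "J = jmat n"
  note assoc = assoc_mult_mat[of _ N N _ N _ N]
  have J: "J \<in> carrier_mat N N" unfolding J_def N_def by simp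
  have JJ: "J * (J * A) = - A" if "A \<in> carrier_mat N N" for A
    using jmat_jmat[of A n N] that by (simp add: J_def N_def)
  have JJ1: "J * J = - 1\<^sub>m N" unfolding J_def N_def by (rule jmat_sq)
  have cJ: "map_mat cnj J = J" by (simp add: J_def)
  define U V where "U = Phi X" and "V = Phi Y"
  have U: "U \<in> carrier_mat N N" and V: "V \<in> carrier_mat N N"
    using X Y by (auto simp: U_def V_def N_def)
  have UJ: "U * J = J * map_mat cnj U" and VJ: "V * J = J * map_mat cnj V"
    unfolding U_def V_def J_def using X Y by (auto simp: Phi_jmat)
  have VJ': "map_mat cnj V * J = J * V"
    using arg_cong[OF VJ, of "map_mat cnj"] V J by (simp add: cnj.mat_hom_mult[of _ N N _ N] cJ)
  obtain P P1 where wit: "similar_mat_wit U V P P1"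
    using sim unfolding similar_mat_def U_def V_def by auto
  note w = similar_mat_witD2[OF U wit]
  have P: "P \<in> carrier_mat N N" and P1: "P1 \<in> carrier_mat N N" and PP1: "P * P1 = 1\<^sub>m N" "P1 * P = 1\<^sub>m N"
    and UE: "U = P * V * P1" using w by auto
  have UP: "U * P = P * V"
    unfolding UE using P P1 V PP1 by (simp add: assoc)
  \<comment> \<open>The conjugate of \<open>P\<close> under the quaternionic structure, as \<open>- J\<close> is the inverse of \<open>J\<close>.\<close>
  define P' where "P' = - (J * map_mat cnj P * J)"
  have P': "P' \<in> carrier_mat N N" unfolding P'_def using P J by simp
  have cP: "map_mat cnj P \<in> carrier_mat N N" "map_mat cnj U \<in> carrier_mat N N" "map_mat cnj V \<in> carrier_mat N N"
    using P U V by auto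
  have UP': "U * P' = P' * V"
  proof -
    have "U * (J * map_mat cnj P * J) = (U * J) * map_mat cnj P * J"
      using U J cP by (simp add: assoc)
    also have "\<dots> = J * (map_mat cnj (U * P)) * J"
      unfolding UJ using U P J cP by (simp add: assoc cnj.mat_hom_mult[of _ N N _ N])
    also have "\<dots> = J * map_mat cnj P * (map_mat cnj V * J)"
      unfolding UP using V P J cP by (simp add: assoc cnj.mat_hom_mult[of _ N N _ N])
    also have "\<dots> = (J * map_mat cnj P * J) * V"
      unfolding VJ' using V P J cP by (simp add: assoc)
    finally show ?thesis unfolding P'_def using U V J cP by simp
  qed
  obtain s where s: "det (Complex s 1 \<cdot>\<^sub>m P + Complex s (-1) \<cdot>\<^sub>m P') \<noteq> 0"
    using exists_nonsingular_combination[OF P P' P1 PP1(1)] by blast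
  define R where "R = Complex s 1 \<cdot>\<^sub>m P + Complex s (-1) \<cdot>\<^sub>m P'"
  have R: "R \<in> carrier_mat N N" unfolding R_def using P P' by simp
  have UR: "U * R = R * V"
    unfolding R_def using U V P P'
    by (simp add: mult_add_distrib_mat[of _ N N _ N] add_mult_distrib_mat[of _ N N _ _ N]
        mult_smult_distrib[of _ N N _ N] mult_smult_assoc_mat[of _ N N _ N] UP UP')
  have P'J: "P' * J = J * map_mat cnj P"
    unfolding P'_def using J cP by (simp add: assoc JJ1)
  have cP': "map_mat cnj P' = - (J * P * J)"
    unfolding P'_def using J cP by (simp add: cnj.mat_hom_mult[of _ N N _ N] cJ cnj_uminus)
  have JcP': "J * map_mat cnj P' = P * J"
    unfolding cP' using J P by (simp add: assoc JJ)
  have cs: "cnj (Complex s 1) = Complex s (-1)" "cnj (Complex s (-1)) = Complex s 1"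
    by (simp_all add: complex_eq_iff)
  have cR: "map_mat cnj R = Complex s (-1) \<cdot>\<^sub>m map_mat cnj P + Complex s 1 \<cdot>\<^sub>m map_mat cnj P'"
    unfolding R_def using P P' by (intro eq_matI) (auto simp: cs)
  have RJ: "R * J = J * map_mat cnj R"
  proof -
    have "R * J = Complex s 1 \<cdot>\<^sub>m (P * J) + Complex s (-1) \<cdot>\<^sub>m (J * map_mat cnj P)"
      unfolding R_def using J P P'
      by (simp add: add_mult_distrib_mat[of _ N N _ _ N] mult_smult_assoc_mat[of _ N N _ N] P'J)
    also have "\<dots> = J * map_mat cnj R"
      unfolding cR using J P cP P'
      by (simp add: mult_add_distrib_mat[of _ N N _ N] mult_smult_distrib[of _ N N _ N] JcP'
          comm_add_mat[of _ N N])
    finally show ?thesis .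
  qed
  obtain Ri where Ri: "Ri \<in> carrier_mat N N" "Ri * R = 1\<^sub>m N" "R * Ri = 1\<^sub>m N"
    using det_nonzero_imp_inverse[OF R] s unfolding R_def by blast
  \<comment> \<open>The range of \<open>Phi\<close> is closed under inverses.\<close>
  have RiJ: "Ri * J = J * map_mat cnj Ri"
  proof -
    have c: "map_mat cnj R \<in> carrier_mat N N" "map_mat cnj Ri \<in> carrier_mat N N" using R Ri by auto
    have 1: "map_mat cnj R * map_mat cnj Ri = 1\<^sub>m N"
      using cnj.mat_hom_mult[OF R Ri(1)] unfolding Ri(3) cnj.mat_hom_one by simp
    have "Ri * J = Ri * J * (map_mat cnj R * map_mat cnj Ri)" unfolding 1 using Ri J by simp
    also have "\<dots> = Ri * (J * map_mat cnj R) * map_mat cnj Ri"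
      using Ri(1) J c by (simp add: assoc)
    also have "\<dots> = (Ri * R) * J * map_mat cnj Ri"
      unfolding RJ[symmetric] using Ri(1) R J c by (simp add: assoc)
    also have "\<dots> = J * map_mat cnj Ri" unfolding Ri using J c by simp
    finally show ?thesis .
  qed
  obtain Q where Q: "Q \<in> carrier_mat n n" "R = Phi Q"
    using Phi_preimage[of R n] R RJ unfolding N_def J_def by blast
  obtain Q' where Q': "Q' \<in> carrier_mat n n" "Ri = Phi Q'"
    using Phi_preimage[of Ri n] Ri RiJ unfolding N_def J_def by blast
  have 1: "Q * Q' = 1\<^sub>m n"
    by (rule Phi_inject[of _ n n]) (use Q Q' Ri in \<open>auto simp: Phi_mult[of _ n n _ n] Phi_one N_def\<close>)
  have 2: "Q' * Q = 1\<^sub>m n"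
    by (rule Phi_inject[of _ n n]) (use Q Q' Ri in \<open>auto simp: Phi_mult[of _ n n _ n] Phi_one N_def\<close>)
  have 3: "X = Q * Y * Q'"
  proof (rule Phi_inject[of _ n n])
    have "Phi (Q * Y * Q') = R * V * Ri"
      unfolding Phi_mult[OF mult_carrier_mat[OF Q(1) Y] Q'(1)] Phi_mult[OF Q(1) Y] V_def Q(2) Q'(2) ..
    also have "\<dots> = U * (R * Ri)" unfolding UR[symmetric] using U R Ri(1) by (simp add: assoc)
    finally show "Phi X = Phi (Q * Y * Q')" unfolding Ri(3) using right_mult_one_mat[OF U] by (simp add: U_def)
  qed (use X Q Q' Y in auto)
  show ?thesis
    by (rule similar_matI[OF _ 1 2 3]) (use X Y Q Q' in auto)
qed

section \<open>Parity of kernels and Jordan blocks\<close>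

text \<open>The columns of \<open>B\<close> are a basis of the kernel: the third property is the spanning property and
the fourth linear independence, both applied to all columns of a matrix at once.\<close>

lemma kernel_basis_matrix:
  assumes A: "(A :: 'a :: field mat) \<in> carrier_mat nr nc"
  obtains B where "B \<in> carrier_mat nc (kernel_dim A)"
    "A * B = 0\<^sub>m nr (kernel_dim A)"
    "\<And>V m. V \<in> carrier_mat nc m \<Longrightarrow> A * V = 0\<^sub>m nr m \<Longrightarrow> \<exists>C \<in> carrier_mat (kernel_dim A) m. V = B * C"
    "\<And>C m. C \<in> carrier_mat (kernel_dim A) m \<Longrightarrow> B * C = 0\<^sub>m nc m \<Longrightarrow> C = 0\<^sub>m (kernel_dim A) m"
proof -
  interpret kernel nr nc A by unfold_locales (rule A)
  obtain S where fin: "finite S" and bas: "basis S" using kernel_basis_exists[OF A] by blast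
  obtain vs where vs: "set vs = S" "distinct vs" using finite_distinct_list[OF fin] by blast
  define d where "d = kernel_dim A"
  have d: "d = length vs"
    using Ker.dim_basis[OF fin bas] vs distinct_card unfolding d_def by fastforce
  have sub: "S \<subseteq> mat_kernel A" using bas unfolding Ker.basis_def by simp
  then have Scar: "v \<in> carrier_vec nc" "A *\<^sub>v v = 0\<^sub>v nr" if "v \<in> S" for v
    using that mat_kernelD[OF A] by auto
  define B where "B = mat_of_cols nc vs"
  have B: "B \<in> carrier_mat nc d" unfolding B_def d by simp
  have colB: "col B j = vs ! j" if "j < d" for j
    unfolding B_def using that Scar vs d by (intro col_mat_of_cols) auto
  have bij: "bij_betw (\<lambda>j. vs ! j) {..<d} S" using bij_betw_nth[OF vs(2)] vs d by auto
  have lin: "B *\<^sub>v c = lincomb a S" if c: "c \<in> carrier_vec d" and a: "\<And>j. j < d \<Longrightarrow> c $ j = a (vs ! j)" for c a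
  proof (rule eq_vecI)
    have l: "lincomb a S \<in> carrier_vec nc"
      using Ker.lincomb_closed[OF sub, of a] mat_kernelD[OF A] by (auto simp: class_field_def)
    then show "dim_vec (B *\<^sub>v c) = dim_vec (lincomb a S)" using B by auto
    fix i assume "i < dim_vec (lincomb a S)"
    then have i: "i < nc" using l by auto
    have "lincomb a S $ i = (\<Sum>j<d. a (vs ! j) * vs ! j $ i)"
      unfolding lincomb_index[OF i sub] by (rule sum.reindex_bij_betw[OF bij, symmetric])
    also have "\<dots> = (B *\<^sub>v c) $ i"
      using i B c a by (auto simp: scalar_prod_def lessThan_atLeast0 B_def mat_of_cols_index d intro!: sum.cong)
    finally show "(B *\<^sub>v c) $ i = lincomb a S $ i" by simp
  qed
  have AB: "A * B = 0\<^sub>m nr d"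
  proof (rule eq_matI)
    fix i j assume ij: "i < dim_row (0\<^sub>m nr d :: 'a mat)" "j < dim_col (0\<^sub>m nr d :: 'a mat)"
    then have "vs ! j \<in> S" using vs d by auto
    from Scar(2)[OF this] have "(A *\<^sub>v vs ! j) $ i = 0" using ij by simp
    then show "(A * B) $$ (i, j) = 0\<^sub>m nr d $$ (i, j)" using ij A B colB by simp
  qed (use A B in auto)
  have span: "\<exists>c \<in> carrier_vec d. v = B *\<^sub>v c" if "v \<in> carrier_vec nc" "A *\<^sub>v v = 0\<^sub>v nr" for v
  proof -
    have "v \<in> span S" using bas that mat_kernelI[OF A] unfolding Ker.basis_def by auto
    then obtain a where a: "lincomb a S = v" using Ker.finite_in_span[OF fin] sub by auto
    have "v = B *\<^sub>v vec d (\<lambda>j. a (vs ! j))" unfolding a[symmetric] by (rule lin[symmetric]) auto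
    then show ?thesis by (intro bexI[of _ "vec d (\<lambda>j. a (vs ! j))"]) auto
  qed
  have inj: "c = 0\<^sub>v d" if c: "c \<in> carrier_vec d" and 0: "B *\<^sub>v c = 0\<^sub>v nc" for c
  proof (rule eq_vecI)
    fix j assume "j < dim_vec (0\<^sub>v d :: 'a vec)"
    then have j: "j < d" by simp
    define a where "a = (\<lambda>x. c $ the_inv_into {..<d} ((!) vs) x)"
    have a: "a (vs ! k) = c $ k" if "k < d" for k
      unfolding a_def using bij that by (simp add: the_inv_into_f_f bij_betw_def)
    have "lincomb a S = 0\<^sub>v nc" using lin[OF c, of a] a 0 by simp
    moreover have "\<not> Ker.lin_dep S" using bas unfolding Ker.basis_def by simp
    moreover have "vs ! j \<in> S" using j vs d by auto
    ultimately have "a (vs ! j) = 0" unfolding Ker.lin_dep_def using fin by auto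
    then show "c $ j = 0\<^sub>v d $ j" using a[OF j] j by simp
  qed (use c in auto)
  show ?thesis
  proof (rule that[of B, folded d_def])
    show "B \<in> carrier_mat nc d" by (rule B)
    show "A * B = 0\<^sub>m nr d" by (rule AB)
    fix m
    show "\<exists>C \<in> carrier_mat d m. V = B * C" if V: "V \<in> carrier_mat nc m" and 0: "A * V = 0\<^sub>m nr m" for V
    proof -
      have "\<exists>c \<in> carrier_vec d. col V j = B *\<^sub>v c" if j: "j < m" for j
      proof (rule span)
        show "col V j \<in> carrier_vec nc" using V j by auto
        have "A *\<^sub>v col V j = col (A * V) j" using V A j by (intro eq_vecI) auto
        then show "A *\<^sub>v col V j = 0\<^sub>v nr" unfolding 0 using j by simp
      qed
      then obtain f where f: "\<And>j. j < m \<Longrightarrow> f j \<in> carrier_vec d \<and> col V j = B *\<^sub>v f j" by metis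
      define C where "C = mat d m (\<lambda>(i,j). f j $ i)"
      have C: "C \<in> carrier_mat d m" by (simp add: C_def)
      have "col C j = f j" if "j < m" for j using f[OF that] that by (intro eq_vecI) (auto simp: C_def)
      then have "V = B * C"
        using f V B C by (intro mat_col_eqI) (auto simp: col_mult2[of _ nc d _ m])
      then show ?thesis using C by blast
    qed
    show "C = 0\<^sub>m d m" if C: "C \<in> carrier_mat d m" and 0: "B * C = 0\<^sub>m nc m" for C
    proof (rule mat_col_eqI)
      fix j assume "j < dim_col (0\<^sub>m d m :: 'a mat)"
      then have j: "j < m" by simp
      have "B *\<^sub>v col C j = 0\<^sub>v nc"
        using col_mult2[OF B C j] j unfolding 0 by simp
      then show "col C j = col (0\<^sub>m d m) j" using inj[of "col C j"] C j by auto
    qed (use C in auto)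
  qed
qed

text \<open>The hypothesis on \<open>A\<close> makes the antilinear map \<open>v \<mapsto> S cnj(v)\<close> preserve the kernel of \<open>A\<close>. In a basis of
the kernel it is given by a \<open>d \<times> d\<close> matrix \<open>C\<close> with \<open>C cnj(C) = -1\<close>, and determinants yield
\<open>|det C|\<^sup>2 = (-1)\<^sup>d\<close>.\<close>

lemma even_kernel_dim:
  fixes A S :: "complex mat"
  assumes A: "A \<in> carrier_mat N N" and S: "S \<in> carrier_mat N N"
    and SS: "S * map_mat cnj S = - 1\<^sub>m N"
    and AS: "A * S = c \<cdot>\<^sub>m (S * map_mat cnj A)"
  shows "even (kernel_dim A)"
proof -
  define d where "d = kernel_dim A"
  obtain B where B: "B \<in> carrier_mat N d" "A * B = 0\<^sub>m N d"
    and ex: "\<And>V m. V \<in> carrier_mat N m \<Longrightarrow> A * V = 0\<^sub>m N m \<Longrightarrow> \<exists>C \<in> carrier_mat d m. V = B * C"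
    and inj: "\<And>C m. C \<in> carrier_mat d m \<Longrightarrow> B * C = 0\<^sub>m N m \<Longrightarrow> C = 0\<^sub>m d m"
    using kernel_basis_matrix[OF A] unfolding d_def by metis
  have c: "map_mat cnj A \<in> carrier_mat N N" "map_mat cnj S \<in> carrier_mat N N" "map_mat cnj B \<in> carrier_mat N d"
    using A S B by auto
  have "A * (S * map_mat cnj B) = A * S * map_mat cnj B"
    using A S c by (simp add: assoc_mult_mat[of _ N N _ N _ d])
  also have "\<dots> = c \<cdot>\<^sub>m (S * map_mat cnj (A * B))"
    unfolding AS using A S B(1) c
    by (simp add: mult_smult_assoc_mat[of _ N N _ d] assoc_mult_mat[of _ N N _ N _ d] cnj.mat_hom_mult[of _ N N _ d])
  also have "\<dots> = 0\<^sub>m N d"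
  proof -
    have "map_mat cnj (0\<^sub>m N d) = 0\<^sub>m N d" by (intro eq_matI) auto
    then show ?thesis unfolding B using S by (simp add: right_mult_zero_mat[of _ N N])
  qed
  finally have "\<exists>C \<in> carrier_mat d d. S * map_mat cnj B = B * C"
    using ex[of "S * map_mat cnj B" d] S c by auto
  then obtain C where C: "C \<in> carrier_mat d d" and SB: "S * map_mat cnj B = B * C" by blast
  have cC: "map_mat cnj C \<in> carrier_mat d d" using C by simp
  have "B * (C * map_mat cnj C) = S * map_mat cnj B * map_mat cnj C"
    unfolding SB using B(1) C cC by (simp add: assoc_mult_mat[of _ N d _ d _ d])
  also have "\<dots> = S * map_mat cnj (B * C)"
    using S B(1) C c cC by (simp add: assoc_mult_mat[of _ N N _ d _ d] cnj.mat_hom_mult[of _ N d _ d])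
  also have "\<dots> = S * map_mat cnj S * B"
    unfolding SB[symmetric] using S B(1) c
    by (simp add: assoc_mult_mat[of _ N N _ N _ d] cnj.mat_hom_mult[of _ N N _ d])
  also have "\<dots> = - B" unfolding SS using B(1) by simp
  finally have "B * (C * map_mat cnj C) = - B" .
  then have "B * (C * map_mat cnj C + 1\<^sub>m d) = 0\<^sub>m N d"
    using B(1) C cC by (simp add: mult_add_distrib_mat[of _ N d _ d])
  then have 0: "C * map_mat cnj C + 1\<^sub>m d = 0\<^sub>m d d"
    using inj[of "C * map_mat cnj C + 1\<^sub>m d" d] C cC by auto
  have "C * map_mat cnj C = (- 1) \<cdot>\<^sub>m 1\<^sub>m d"
  proof (rule eq_matI)
    fix i j assume ij: "i < dim_row ((- 1 :: complex) \<cdot>\<^sub>m 1\<^sub>m d)" "j < dim_col ((- 1 :: complex) \<cdot>\<^sub>m 1\<^sub>m d)"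
    then have "(C * map_mat cnj C + 1\<^sub>m d) $$ (i,j) = 0" unfolding 0 by simp
    then show "(C * map_mat cnj C) $$ (i,j) = ((- 1) \<cdot>\<^sub>m 1\<^sub>m d) $$ (i,j)"
      using ij C by (auto simp: eq_neg_iff_add_eq_0)
  qed (use C in auto)
  then have "det C * cnj (det C) = (- 1) ^ d"
    using det_mult[OF C cC] C by simp
  then have "complex_of_real ((cmod (det C))\<^sup>2) = complex_of_real ((- 1) ^ d)"
    by (metis complex_norm_square of_real_1 of_real_minus of_real_power)
  then have "(cmod (det C))\<^sup>2 = (- 1) ^ d" by (simp only: of_real_eq_iff)
  then have "(- 1 :: real) ^ d \<ge> 0" by (metis zero_le_power2)
  then have "even d" by (cases "even d") auto
  then show ?thesis unfolding d_def .
qed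

text \<open>The condition \<open>z = c cnj(z)\<close> passes the relation between \<open>M\<close> and \<open>S\<close> on to \<open>M - z\<close> and its powers, so all
generalised eigenspaces at \<open>z\<close> have even dimension. The cases of interest are \<open>c = 1\<close> with \<open>z\<close> real and
\<open>c = -1\<close> with \<open>z\<close> purely imaginary.\<close>

lemma even_nr_of_jordan_blocks:
  fixes M S :: "complex mat"
  assumes M: "M \<in> carrier_mat N N" and S: "S \<in> carrier_mat N N"
    and SS: "S * map_mat cnj S = - 1\<^sub>m N"
    and MS: "M * S = c \<cdot>\<^sub>m (S * map_mat cnj M)" and z: "z = c * cnj z"
  shows "even (compute_nr_of_jordan_blocks M z k)"
proof -
  define A where "A = char_matrix M z"
  have A: "A \<in> carrier_mat N N" unfolding A_def using M by simp
  have cA: "map_mat cnj A = map_mat cnj M + (- cnj z) \<cdot>\<^sub>m 1\<^sub>m N"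
    unfolding A_def char_matrix_def using M by (intro eq_matI) auto
  have AS: "A * S = c \<cdot>\<^sub>m (S * map_mat cnj A)"
  proof -
    have "A * S = M * S + (- z) \<cdot>\<^sub>m S"
      unfolding A_def char_matrix_def using M S
      by (simp add: add_mult_distrib_mat[of _ N N _ _ N] mult_smult_assoc_mat[of _ N N _ N])
    moreover have "S * map_mat cnj A = S * map_mat cnj M + (- cnj z) \<cdot>\<^sub>m S"
      unfolding cA using M S
      by (simp add: mult_add_distrib_mat[of _ N N _ N] mult_smult_distrib[of _ N N _ N])
    ultimately show ?thesis
      unfolding MS using M S z by (intro eq_matI) (auto simp: algebra_simps)
  qed
  have pow: "A ^\<^sub>m j * S = c ^ j \<cdot>\<^sub>m (S * map_mat cnj (A ^\<^sub>m j))" for j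
  proof (induction j)
    case 0
    have "1 \<cdot>\<^sub>m S = S" by (intro eq_matI) auto
    then show ?case using S A by (simp add: cnj.mat_hom_one)
  next
    case (Suc j)
    have c: "A ^\<^sub>m j \<in> carrier_mat N N" "map_mat cnj A \<in> carrier_mat N N"
      "map_mat cnj (A ^\<^sub>m j) \<in> carrier_mat N N" using A by auto
    have "A ^\<^sub>m Suc j * S = A ^\<^sub>m j * (A * S)"
      using assoc_mult_mat[OF c(1) A S] by simp
    also have "\<dots> = c \<cdot>\<^sub>m (A ^\<^sub>m j * S * map_mat cnj A)"
      unfolding AS using c S by (simp add: mult_smult_distrib[of _ N N _ N] assoc_mult_mat[of _ N N _ N _ N])
    also have "\<dots> = c ^ Suc j \<cdot>\<^sub>m (S * (map_mat cnj (A ^\<^sub>m j) * map_mat cnj A))"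
      unfolding Suc using c S
      by (simp add: mult_smult_assoc_mat[of _ N N _ N] assoc_mult_mat[of _ N N _ N _ N])
        (intro eq_matI, auto)
    also have "map_mat cnj (A ^\<^sub>m j) * map_mat cnj A = map_mat cnj (A ^\<^sub>m Suc j)"
      using cnj.mat_hom_mult[OF c(1) A] by simp
    finally show ?case .
  qed
  have "even (dim_gen_eigenspace M z j)" for j
    unfolding dim_gen_eigenspace_def A_def[symmetric]
    by (rule even_kernel_dim[OF _ S SS pow]) (use A in auto)
  then show ?thesis
    unfolding compute_nr_of_jordan_blocks_def by (simp add: even_diff_nat)
qed

section \<open>Jordan forms as multisets of blocks\<close>

lemma count_jordan_nf:
  assumes "jordan_nf (M :: 'a :: field mat) as" "k \<noteq> 0"
  shows "count (mset as) (k, z) = compute_nr_of_jordan_blocks M z k"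
  unfolding compute_nr_of_jordan_blocks[OF assms] by (simp add: count_mset count_list_eq_length_filter)

lemma count_jordan_nf_0: "jordan_nf M as \<Longrightarrow> count (mset as) (0, z) = 0"
  unfolding jordan_nf_def by (force simp: count_eq_zero_iff)

lemma jordan_nf_mset_unique:
  assumes "jordan_nf (M :: 'a :: field mat) as" "jordan_nf M bs"
  shows "mset as = mset bs"
proof (rule multiset_eqI)
  fix x :: "nat \<times> 'a"
  obtain k z where x: "x = (k, z)" by fastforce
  show "count (mset as) x = count (mset bs) x"
    by (cases "k = 0") (simp_all add: x count_jordan_nf[OF assms(1)] count_jordan_nf[OF assms(2)]
        count_jordan_nf_0[OF assms(1)] count_jordan_nf_0[OF assms(2)])
qed

text \<open>The block permutation matrix exchanging the two summands conjugates one matrix into the other.\<close>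

lemma similar_mat_swap_blocks:
  fixes A B :: "'a :: comm_ring_1 mat"
  assumes A: "A \<in> carrier_mat n n" and B: "B \<in> carrier_mat m m"
  shows "similar_mat (four_block_mat A (0\<^sub>m n m) (0\<^sub>m m n) B) (four_block_mat B (0\<^sub>m m n) (0\<^sub>m n m) A)"
proof -
  define P where "P = four_block_mat (0\<^sub>m n m) (1\<^sub>m n) (1\<^sub>m m) (0\<^sub>m m n :: 'a mat)"
  define Q where "Q = four_block_mat (0\<^sub>m m n) (1\<^sub>m m) (1\<^sub>m n) (0\<^sub>m n m :: 'a mat)"
  have PQ: "P * Q = 1\<^sub>m (n + m)"
    unfolding P_def Q_def four_block_one_mat[symmetric]
    by (subst mult_four_block_mat[of _ n m _ n _ m _ _ n _ m]) (auto intro!: cong_four_block_mat)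
  have QP: "Q * P = 1\<^sub>m (n + m)"
    unfolding P_def Q_def add.commute[of n m] four_block_one_mat[symmetric, of m n]
    by (subst mult_four_block_mat[of _ m n _ m _ n _ _ m _ n]) (auto intro!: cong_four_block_mat)
  have eq: "four_block_mat A (0\<^sub>m n m) (0\<^sub>m m n) B = P * four_block_mat B (0\<^sub>m m n) (0\<^sub>m n m) A * Q"
    unfolding P_def Q_def using A B
    by (subst mult_four_block_mat[of _ n m _ n _ m _ _ m _ n], auto)
      (subst mult_four_block_mat[of _ n m _ n _ m _ _ n _ m], auto intro!: cong_four_block_mat)
  have "P \<in> carrier_mat (n + m) (n + m)" "Q \<in> carrier_mat (n + m) (n + m)"
    "four_block_mat A (0\<^sub>m n m) (0\<^sub>m m n) B \<in> carrier_mat (n + m) (n + m)"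
    "four_block_mat B (0\<^sub>m m n) (0\<^sub>m n m) A \<in> carrier_mat (n + m) (n + m)"
    using A B by (auto intro!: carrier_matI simp: P_def Q_def)
  then show ?thesis
    by (intro similar_matI[OF _ PQ QP eq]) simp
qed

lemma jordan_matrix_append:
  "jordan_matrix (as @ bs) = four_block_mat (jordan_matrix as)
     (0\<^sub>m (sum_list (map fst as)) (sum_list (map fst bs)))
     (0\<^sub>m (sum_list (map fst bs)) (sum_list (map fst as))) (jordan_matrix bs)"
  unfolding jordan_matrix_def map_append diag_block_mat_append
  by (simp add: Let_def flip: jordan_matrix_def)

lemma similar_mat_jordan_matrix_append_cong:
  fixes as :: "(nat \<times> 'a :: field) list"
  assumes "similar_mat (jordan_matrix as) (jordan_matrix as')"
    and "similar_mat (jordan_matrix bs) (jordan_matrix bs')"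
  shows "similar_mat (jordan_matrix (as @ bs)) (jordan_matrix (as' @ bs'))"
proof -
  have "sum_list (map fst as) = sum_list (map fst as')" "sum_list (map fst bs) = sum_list (map fst bs')"
    using similar_matD[OF assms(1)] similar_matD[OF assms(2)]
    by (metis carrier_matD(1) insert_subset jordan_matrix_dim(1))+
  then show ?thesis
    unfolding jordan_matrix_append
    using similar_mat_four_block_0_0[OF assms jordan_matrix_carrier jordan_matrix_carrier] by simp
qed

lemma similar_mat_jordan_matrix_perm:
  fixes as bs :: "(nat \<times> 'a :: field) list"
  assumes "mset as = mset bs"
  shows "similar_mat (jordan_matrix as) (jordan_matrix bs)"
  using assms
proof (induction as arbitrary: bs)
  case Nil
  then show ?case by (auto intro: similar_mat_refl[OF jordan_matrix_carrier])
next
  case (Cons a as)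
  have "a \<in> set bs" using Cons.prems by (metis list.set_intros(1) set_mset_mset)
  then obtain ys zs where bs: "bs = ys @ a # zs" by (meson split_list)
  have "mset as = mset (ys @ zs)" using Cons.prems by (simp add: bs)
  from Cons.IH[OF this] have "similar_mat (jordan_matrix ([a] @ as)) (jordan_matrix ([a] @ (ys @ zs)))"
    by (rule similar_mat_jordan_matrix_append_cong[OF similar_mat_refl[OF jordan_matrix_carrier]])
  moreover have "similar_mat (jordan_matrix ([a] @ ys)) (jordan_matrix (ys @ [a]))"
    unfolding jordan_matrix_append
    by (rule similar_mat_swap_blocks) (rule jordan_matrix_carrier)+
  from similar_mat_jordan_matrix_append_cong[OF this similar_mat_refl[OF jordan_matrix_carrier], of zs]
  have "similar_mat (jordan_matrix ([a] @ (ys @ zs))) (jordan_matrix bs)" by (simp add: bs)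
  ultimately show ?case using similar_mat_trans by fastforce
qed

lemma similar_mat_if_jordan_nf_mset:
  fixes A B :: "'a :: field mat"
  assumes A: "jordan_nf A as" and B: "jordan_nf B bs" and eq: "mset as = mset bs"
  shows "similar_mat A B"
  using A B similar_mat_jordan_matrix_perm[OF eq] similar_mat_trans similar_mat_sym
  unfolding jordan_nf_def by blast

lemma jordan_nf_four_block:
  fixes A B :: "'a :: field mat"
  assumes A: "jordan_nf A as" "A \<in> carrier_mat n n" and B: "jordan_nf B bs" "B \<in> carrier_mat m m"
  shows "jordan_nf (four_block_mat A (0\<^sub>m n m) (0\<^sub>m m n) B) (as @ bs)"
proof -
  have "sum_list (map fst as) = n" "sum_list (map fst bs) = m"
    using similar_matD A B unfolding jordan_nf_def by (metis carrier_matD(1) insert_subset jordan_matrix_dim(1))+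
  then have "similar_mat (four_block_mat A (0\<^sub>m n m) (0\<^sub>m m n) B) (jordan_matrix (as @ bs))"
    using similar_mat_four_block_0_0[OF _ _ A(2) B(2), of "jordan_matrix as" "jordan_matrix bs"] A(1) B(1)
    unfolding jordan_matrix_append jordan_nf_def by auto
  then show ?thesis using A(1) B(1) unfolding jordan_nf_def by auto
qed

lemma jordan_nf_jordan_matrix: "0 \<notin> fst ` set as \<Longrightarrow> jordan_nf (jordan_matrix as) as"
  unfolding jordan_nf_def using similar_mat_refl[OF jordan_matrix_carrier] by blast

lemma map_fst_apsnd [simp]: "map fst (map (apsnd f) bs) = map fst bs"
  by simp

lemma jordan_matrix_apsnd:
  assumes "f 0 = 0" "f 1 = 1"
  shows "jordan_matrix (map (apsnd f) bs) = map_mat f (jordan_matrix bs)"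
proof (induction bs)
  case Nil
  show ?case by (auto simp: jordan_matrix_def)
next
  case (Cons b bs)
  obtain m z where b: "b = (m, z)" by fastforce
  show ?case
    unfolding b list.map apsnd_conv jordan_matrix_Cons Cons map_fst_apsnd
    by (rule eq_matI) (auto simp: assms)
qed

lemma jordan_nf_cnj:
  assumes "jordan_nf A as"
  shows "jordan_nf (map_mat cnj A) (map (apsnd cnj) as)"
proof -
  obtain n P Q where c: "{A,jordan_matrix as,P,Q} \<subseteq> carrier_mat n n" 
    and 1: "P * Q = 1\<^sub>m n" "Q * P = 1\<^sub>m n" "A = P * jordan_matrix as * Q"
    using similar_matD assms unfolding jordan_nf_def by blast
  have "similar_mat (map_mat cnj A) (map_mat cnj (jordan_matrix as))"
  proof (rule similar_matI[of _ _ "map_mat cnj P" "map_mat cnj Q" n])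
    show "map_mat cnj P * map_mat cnj Q = 1\<^sub>m n" "map_mat cnj Q * map_mat cnj P = 1\<^sub>m n"
      using c by (simp_all add: 1 cnj.mat_hom_one flip: cnj.mat_hom_mult[of _ n n _ n])
    have "P * jordan_matrix as \<in> carrier_mat n n" using c by (intro mult_carrier_mat[of _ n n]) auto
    from cnj.mat_hom_mult[OF this, of Q n]
    show "map_mat cnj A = map_mat cnj P * map_mat cnj (jordan_matrix as) * map_mat cnj Q"
      using c by (simp add: 1(3) cnj.mat_hom_mult[of _ n n _ n])
  qed (use c in auto)
  then show ?thesis
    using assms unfolding jordan_nf_def by (force simp: jordan_matrix_apsnd)
qed

lemma jordan_nf_complex_exists:
  assumes "(A :: complex mat) \<in> carrier_mat n n"
  obtains as where "jordan_nf A as"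
  using char_poly_factorized[OF assms] jordan_nf_exists[OF assms] by blast

section \<open>The quaternionic Jordan form\<close>

text \<open>Remove \<open>x\<close> and \<open>\<sigma> x\<close> from \<open>M\<close> until nothing is left; at a fixed point, evenness provides the second copy.\<close>

lemma multiset_halve_by_involution:
  assumes inv: "\<And>x. \<sigma> (\<sigma> x) = x"
    and sym: "\<And>x. count M (\<sigma> x) = count M x"
    and fix_even: "\<And>x. \<sigma> x = x \<Longrightarrow> even (count M x)"
  shows "\<exists>H. M = H + image_mset \<sigma> H"
  using sym fix_even
proof (induction M rule: measure_induct_rule[of size])
  case (less M)
  show ?case
  proof (cases "M = {#}")
    case False
    then obtain x where x: "x \<in># M" by blast
    have sub: "{#x, \<sigma> x#} \<subseteq># M"
    proof (cases "\<sigma> x = x")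
      case True
      have "count M x \<noteq> 1" using less.prems(2)[OF True] by auto
      moreover have "count M x > 0" using x by simp
      ultimately have "count M x \<ge> 2" by linarith
      then show ?thesis using True by (auto simp: subseteq_mset_def)
    next
      case False
      have "\<sigma> x \<in># M" using x less.prems(1)[of x] by (metis count_eq_zero_iff)
      then show ?thesis using x False
        by (auto simp: subseteq_mset_def Suc_le_eq count_greater_zero_iff)
    qed
    define M' where "M' = M - {#x, \<sigma> x#}"
    have M: "M = M' + {#x, \<sigma> x#}" by (simp only: M'_def subset_mset.diff_add[OF sub])
    have iff: "\<sigma> y = x \<longleftrightarrow> y = \<sigma> x" "\<sigma> y = \<sigma> x \<longleftrightarrow> y = x" for y using inv by metis+
    have cnt: "count M' y = count M y - (if y = x then 1 else 0) - (if y = \<sigma> x then 1 else 0)" for y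
      unfolding M'_def by auto
    have "\<exists>H. M' = H + image_mset \<sigma> H"
    proof (rule less.IH)
      show "size M' < size M" unfolding M by simp
      show "count M' (\<sigma> y) = count M' y" for y
        unfolding cnt less.prems(1) iff by auto
      show "even (count M' y)" if y: "\<sigma> y = y" for y
        using less.prems(2)[OF y] y iff[of y] unfolding cnt by auto
    qed
    then obtain H where "M' = H + image_mset \<sigma> H" by blast
    then have "M = add_mset x H + image_mset \<sigma> (add_mset x H)" unfolding M by simp
    then show ?thesis by blast
  qed simp
qed

lemma Phi_jordan_matrix:
  "Phi (jordan_matrix (map (apsnd quat_of_complex) bs)) = jordan_matrix (bs @ map (apsnd cnj) bs)"
  by (simp add: jordan_matrix_apsnd Phi_quat_of_complex[OF jordan_matrix_carrier] jordan_matrix_append)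

text \<open>Conjugation by \<open>jmat n\<close>, whose inverse is its negative.\<close>

lemma similar_mat_cnj_Phi:
  assumes X: "X \<in> carrier_mat n n"
  shows "similar_mat (Phi X) (map_mat cnj (Phi X))"
proof (rule similar_matI[of _ _ "jmat n" "- jmat n" "n + n"])
  show "jmat n * - jmat n = 1\<^sub>m (n + n)" "- jmat n * jmat n = 1\<^sub>m (n + n)"
    by (rule jmat_inverse)+
  have "jmat n * map_mat cnj (Phi X) * - jmat n = Phi X * (jmat n * - jmat n)"
    unfolding Phi_jmat[OF X, symmetric] using X
    by (subst assoc_mult_mat[of _ "n+n" "n+n" _ "n+n" _ "n+n"]) auto
  also have "jmat n * - jmat n = 1\<^sub>m (n + n)" by (rule jmat_inverse)
  finally show "Phi X = jmat n * map_mat cnj (Phi X) * - jmat n"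
    using right_mult_one_mat[OF Phi_carrier[OF X]] by simp
qed (use X in auto)

lemma count_jordan_nf_Phi_cnj:
  assumes X: "X \<in> carrier_mat n n" and as: "jordan_nf (Phi X) as"
  shows "count (mset as) (apsnd cnj x) = count (mset as) x"
proof -
  have "jordan_nf (map_mat cnj (Phi X)) as"
    using as similar_mat_cnj_Phi[OF X] similar_mat_trans similar_mat_sym unfolding jordan_nf_def by blast
  from jordan_nf_mset_unique[OF this jordan_nf_cnj[OF as]]
  have eq: "mset as = image_mset (apsnd cnj) (mset as)" by simp
  have "inj (apsnd cnj :: nat \<times> complex \<Rightarrow> _)" by (auto simp: inj_def)
  then have "count (image_mset (apsnd cnj) M) (apsnd cnj x) = count M x" for M :: "(nat \<times> complex) multiset"
    by (induction M) (auto simp: inj_eq)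
  then have "count (image_mset (apsnd cnj) (mset as)) (apsnd cnj x) = count (mset as) x" .
  then show ?thesis using eq by simp
qed

lemma quat_jordan_form_Phi:
  assumes "quat_jordan_form X bs"
  shows "jordan_nf (Phi X) (bs @ map (apsnd cnj) bs)"
proof -
  have e: "(\<lambda>(m, z). (m, quat_of_complex z)) = apsnd quat_of_complex" by auto
  have nf: "jordan_nf X (map (apsnd quat_of_complex) bs)"
    using assms unfolding quat_jordan_form_def e by blast
  then have "similar_mat (Phi X) (jordan_matrix (bs @ map (apsnd cnj) bs))"
    using similar_mat_Phi unfolding jordan_nf_def Phi_jordan_matrix[symmetric] by blast
  moreover have "0 \<notin> fst ` set (bs @ map (apsnd cnj) bs)"
    using nf unfolding jordan_nf_def by force
  ultimately show ?thesis unfolding jordan_nf_def by blast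
qed

text \<open>The Jordan blocks of \<open>Phi X\<close> are halved along complex conjugation of the eigenvalue; the parity
lemma with \<open>S = jmat n\<close> covers the fixed points, which are the real eigenvalues. Choosing from each
conjugate pair the eigenvalue in the upper half plane gives the quaternionic blocks, and descent the
similarity.\<close>

lemma quat_jordan_form_exists:
  assumes X: "X \<in> carrier_mat n n"
  shows "\<exists>bs. quat_jordan_form X bs"
proof -
  obtain as where as: "jordan_nf (Phi X) as" using jordan_nf_complex_exists Phi_carrier[OF X] by blast
  have "\<exists>H. mset as = H + image_mset (apsnd cnj) H"
  proof (rule multiset_halve_by_involution)
    show "apsnd cnj (apsnd cnj x) = x" for x :: "nat \<times> complex" by (cases x) simp
    show "count (mset as) (apsnd cnj x) = count (mset as) x" for x
      by (rule count_jordan_nf_Phi_cnj[OF X as])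
    show "even (count (mset as) x)" if fixed: "apsnd cnj x = x" for x
    proof -
      obtain k z where x: "x = (k, z)" by fastforce
      have z: "cnj z = z" using fixed x by simp
      have "even (compute_nr_of_jordan_blocks (Phi X) z k)"
        by (rule even_nr_of_jordan_blocks[of _ "n + n" "jmat n" 1])
          (use X z in \<open>auto simp: jmat_sq Phi_jmat\<close>)
      then show ?thesis
        by (cases "k = 0") (simp_all add: x count_jordan_nf[OF as] count_jordan_nf_0[OF as] del: count_mset_0_iff)
    qed
  qed
  then obtain H where H: "mset as = H + image_mset (apsnd cnj) H" by blast
  \<comment> \<open>Both members of a conjugate pair give the same multiset \<open>{z, cnj(z)}\<close>, so the representative may be chosen.\<close>
  define up where "up = (\<lambda>z. if Im z \<ge> 0 then z else cnj z)"
  have "image_mset (apsnd up) H + image_mset (apsnd cnj) (image_mset (apsnd up) H) = H + image_mset (apsnd cnj) H"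
    by (induction H) (auto simp: up_def apsnd_def map_prod_def split: prod.splits)
  moreover obtain bs where bs: "mset bs = image_mset (apsnd up) H" using ex_mset by blast
  ultimately have eq: "mset as = mset (bs @ map (apsnd cnj) bs)" using H by simp
  have Im: "Im z \<ge> 0" if "(m, z) \<in> set bs" for m z
  proof -
    have "(m, z) \<in># image_mset (apsnd up) H" using that bs by (metis set_mset_mset)
    then show ?thesis by (auto simp: up_def)
  qed
  have "set as = set (bs @ map (apsnd cnj) bs)" using eq mset_eq_setD by blast
  then have nz: "0 \<notin> fst ` set bs" using as unfolding jordan_nf_def by auto
  have sim: "similar_mat (Phi X) (Phi (jordan_matrix (map (apsnd quat_of_complex) bs)))"
    unfolding Phi_jordan_matrix
    using similar_mat_jordan_matrix_perm[OF eq] as similar_mat_trans unfolding jordan_nf_def by blast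
  have "similar_mat X (jordan_matrix (map (apsnd quat_of_complex) bs))"
  proof (rule similar_mat_if_similar_mat_Phi[OF X _ sim])
    obtain N where "Phi X \<in> carrier_mat N N"
      "Phi (jordan_matrix (map (apsnd quat_of_complex) bs)) \<in> carrier_mat N N"
      using similar_matD[OF sim] by blast
    from carrier_matD(1)[OF this(1)] carrier_matD(1)[OF this(2)]
    have "n + n = sum_list (map fst bs) + sum_list (map fst bs)"
      using carrier_matD(1)[OF X] by simp
    then have "sum_list (map fst bs) = n" by simp
    then show "jordan_matrix (map (apsnd quat_of_complex) bs) \<in> carrier_mat n n"
      using jordan_matrix_carrier[of "map (apsnd quat_of_complex) bs"] by simp
  qed
  moreover have e: "(\<lambda>(m, z). (m, quat_of_complex z)) = apsnd quat_of_complex" by auto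
  ultimately have "quat_jordan_form X bs"
    unfolding quat_jordan_form_def jordan_nf_def e using Im nz by (auto simp: image_image)
  then show ?thesis by blast
qed

lemma jordan_blocks_quat_jordan_form:
  assumes "X \<in> carrier_mat n n"
  obtains bs where "quat_jordan_form X bs" "jordan_blocks X = mset bs"
  using someI_ex[OF quat_jordan_form_exists[OF assms]] unfolding jordan_blocks_def by blast

lemma count_map_apsnd_cnj:
  "count (mset (map (apsnd cnj) bs)) (k, z) = count (mset bs) (k, cnj z)"
  by (induction bs) (auto simp: apsnd_def map_prod_def split: prod.splits)

lemma quat_jordan_form_Im: "quat_jordan_form X bs \<Longrightarrow> (m, z) \<in> set bs \<Longrightarrow> Im z \<ge> 0"
  unfolding quat_jordan_form_def by auto

lemma count_eq_0_if_Im_neg: "quat_jordan_form X bs \<Longrightarrow> Im z < 0 \<Longrightarrow> count (mset bs) (k, z) = 0"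
  using quat_jordan_form_Im by fastforce

lemma count_quat_jordan_form:
  assumes bs: "quat_jordan_form X bs" and as: "jordan_nf (Phi X) as"
  shows "count (mset as) (k, z) = count (mset bs) (k, z) + count (mset bs) (k, cnj z)"
  unfolding jordan_nf_mset_unique[OF as quat_jordan_form_Phi[OF bs]]
  by (simp add: count_map_apsnd_cnj[unfolded mset_map])

lemma count_eigen_partition:
  assumes "jordan_blocks X = mset bs"
  shows "count (eigen_partition X \<mu>) d = count (mset bs) (d, \<mu>)"
proof -
  have "count (image_mset fst {#b \<in># M. snd b = \<mu>#}) d = count M (d, \<mu>)" for M :: "(nat \<times> complex) multiset"
    by (induction M) auto
  then show ?thesis unfolding eigen_partition_def assms .
qed

text \<open>The first basis vector belonging to the block is an eigenvector of the Jordan matrix, and the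
similarity carries it to an eigenvector of \<open>X\<close>.\<close>

lemma block_eigenvalue_rep:
  assumes X: "X \<in> carrier_mat n n" and bs: "quat_jordan_form X bs" and mz: "(m, z) \<in> set bs"
  shows "z \<in> eigenvalue_reps X"
proof -
  have e: "(\<lambda>(m, z). (m, quat_of_complex z)) = apsnd quat_of_complex" by auto
  have nf: "jordan_nf X (map (apsnd quat_of_complex) bs)"
    using bs unfolding quat_jordan_form_def e by blast
  define q where "q = quat_of_complex z"
  define J where "J = jordan_matrix (map (apsnd quat_of_complex) bs)"
  obtain P Q where "similar_mat_wit X J P Q" using nf unfolding jordan_nf_def similar_mat_def J_def by blast
  note w = similar_mat_witD2[OF X this]
  have J: "J \<in> carrier_mat n n" and P: "P \<in> carrier_mat n n" and Q: "Q \<in> carrier_mat n n"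
    and PQ: "P * Q = 1\<^sub>m n" "Q * P = 1\<^sub>m n" and XE: "X = P * J * Q" using w by auto
  obtain b1 b2 where split: "map (apsnd quat_of_complex) bs = b1 @ (m, q) # b2"
    using split_list[of "(m, q)" "map (apsnd quat_of_complex) bs"] mz unfolding q_def by force
  have "m \<noteq> 0" using nf unfolding jordan_nf_def split by force
  define i where "i = sum_list (map fst b1)"
  have n: "n = i + (m + sum_list (map fst b2))"
    using carrier_matD(1)[OF J] unfolding J_def split jordan_matrix_dim i_def by simp
  have i: "i < n" using n \<open>m \<noteq> 0\<close> by simp
  have Jcol: "J $$ (k, i) = (if k = i then q else 0)" if "k < n" for k
    unfolding J_def split jordan_matrix_append jordan_matrix_Cons
    using that n \<open>m \<noteq> 0\<close> by (auto simp: i_def)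
  have XP: "X * P = P * J"
  proof -
    have "X * P = P * J * (Q * P)" unfolding XE using assoc_mult_mat[OF mult_carrier_mat[OF P J] Q P] .
    then show ?thesis unfolding PQ using right_mult_one_mat[OF mult_carrier_mat[OF P J]] by simp
  qed
  \<comment> \<open>Column \<open>i\<close> is the first column of the chosen block, so column \<open>i\<close> of \<open>J\<close> is \<open>q\<close> times a unit vector.\<close>
  define v where "v = col P i"
  have v: "v \<in> carrier_vec n" unfolding v_def using P by auto
  have "X *\<^sub>v v = map_vec (\<lambda>x. x * q) v"
  proof (rule eq_vecI)
    fix r assume "r < dim_vec (map_vec (\<lambda>x. x * q) v)"
    then have r: "r < n" using v by auto
    have "(X *\<^sub>v v) $ r = (X * P) $$ (r, i)" using X P r i by (simp add: v_def)
    also have "\<dots> = (\<Sum>k<n. P $$ (r, k) * J $$ (k, i))"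
      unfolding XP using P J r i by (auto simp: scalar_prod_def lessThan_atLeast0)
    also have "\<dots> = (\<Sum>k<n. if k = i then P $$ (r, i) * q else 0)"
      by (rule sum.cong) (auto simp: Jcol)
    also have "\<dots> = P $$ (r, i) * q" using i by simp
    finally show "(X *\<^sub>v v) $ r = map_vec (\<lambda>x. x * q) v $ r" using P r i by (simp add: v_def)
  qed (use X v in auto)
  moreover have "v \<noteq> 0\<^sub>v n"
  proof
    assume 0: "v = 0\<^sub>v n"
    have "(Q * P) $$ (i, i) = row Q i \<bullet> v" using P Q i by (simp add: v_def)
    also have "\<dots> = 0" unfolding 0 using Q i by simp
    finally show False using i unfolding PQ by simp
  qed
  ultimately have "right_eigenvalue X q" unfolding right_eigenvalue_def using X v by auto
  moreover have "q \<in> similarity_class q"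
    unfolding similarity_class_def by (rule CollectI, rule exI[of _ 1]) simp
  moreover have "Im z \<ge> 0" using quat_jordan_form_Im[OF bs mz] .
  ultimately show ?thesis unfolding eigenvalue_reps_def q_def by blast
qed

section \<open>Anticommuting involutions force even multiplicities\<close>

text \<open>Since \<open>Phi g\<close> anticommutes with \<open>Phi X\<close> and commutes with the quaternionic structure, their
composition \<open>v \<mapsto> Phi(g) J cnj(v)\<close> again has square \<open>-1\<close>, and the parity lemma applies to it with
\<open>c = -1\<close>.\<close>

lemma even_blocks_if_anticommuting_involution:
  assumes X: "X \<in> carrier_mat n n" and g: "g \<in> carrier_mat n n"
    and gg: "g * g = 1\<^sub>m n" and Xg: "X * g = - (g * X)"
    and bs: "quat_jordan_form X bs" and z: "Re z = 0" "Im z > 0"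
  shows "even (count (mset bs) (k, z))"
proof -
  define N where "N = n + n"
  define M G J where "M = Phi X" and "G = Phi g" and "J = jmat n"
  have M: "M \<in> carrier_mat N N" and G: "G \<in> carrier_mat N N" and J: "J \<in> carrier_mat N N"
    using X g by (auto simp: M_def G_def J_def N_def)
  note assoc = assoc_mult_mat[of _ N N _ N _ N]
  have GJ: "J * map_mat cnj G = G * J" and MJ: "J * map_mat cnj M = M * J"
    using X g by (auto simp: M_def G_def J_def Phi_jmat)
  have GG: "G * G = 1\<^sub>m N" using g gg by (simp add: G_def N_def Phi_one flip: Phi_mult[of _ n n _ n])
  have MG: "M * G = - (G * M)"
    using arg_cong[OF Xg, of Phi] X g by (simp add: M_def G_def Phi_uminus Phi_mult[of _ n n _ n])
  have cM: "map_mat cnj M \<in> carrier_mat N N" "map_mat cnj G \<in> carrier_mat N N" using M G by auto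
  have "even (compute_nr_of_jordan_blocks M z k)"
  proof (rule even_nr_of_jordan_blocks[OF M, of "G * J" "- 1"])
    show "G * J \<in> carrier_mat N N" using G J by simp
    have "map_mat cnj (G * J) = map_mat cnj G * J"
      using cnj.mat_hom_mult[OF G J] by (simp add: J_def)
    then have "G * J * map_mat cnj (G * J) = G * (J * map_mat cnj G) * J"
      using G J cM by (simp add: assoc)
    also have "\<dots> = (G * G) * (J * J)" unfolding GJ using G J by (simp add: assoc)
    finally show "G * J * map_mat cnj (G * J) = - 1\<^sub>m N"
      unfolding GG by (simp add: J_def N_def jmat_sq)
    have "M * (G * J) = M * G * J" using M G J by (simp add: assoc)
    also have "\<dots> = - (G * (M * J))" unfolding MG using M G J by (simp add: assoc)
    also have "\<dots> = (- 1) \<cdot>\<^sub>m (G * J * map_mat cnj M)"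
      unfolding MJ[symmetric] using G J cM by (simp add: assoc) (intro eq_matI, auto)
    finally show "M * (G * J) = (- 1) \<cdot>\<^sub>m (G * J * map_mat cnj M)" .
    show "z = - 1 * cnj z" using z by (simp add: complex_eq_iff)
  qed
  moreover have as: "jordan_nf M (bs @ map (apsnd cnj) bs)"
    unfolding M_def by (rule quat_jordan_form_Phi[OF bs])
  ultimately have "even (count (mset (bs @ map (apsnd cnj) bs)) (k, z))"
    by (cases "k = 0") (simp_all add: count_jordan_nf[OF as] count_jordan_nf_0[OF as] del: count_mset_0_iff mset_append)
  then have "even (count (mset bs) (k, z) + count (mset bs) (k, cnj z))"
    using count_quat_jordan_form[OF bs as[unfolded M_def]] by simp
  then show ?thesis using count_eq_0_if_Im_neg[OF bs, of "cnj z" k] z by simp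
qed

section \<open>Symmetry of the blocks of an Ad-real matrix\<close>

lemma count_neg_if_similar_uminus:
  assumes as: "jordan_nf (M :: 'a :: field mat) as" and sim: "similar_mat (- M) M"
  shows "count (mset as) (k, - z) = count (mset as) (k, z)"
proof -
  have "(- 1) \<cdot>\<^sub>m M = - M" by (intro eq_matI) auto
  then have "jordan_nf (- M) (map (apsnd uminus) as)"
    using jordan_nf_smult[OF as, of "- 1"] by (simp add: apsnd_def map_prod_def)
  moreover have "jordan_nf (- M) as"
    using as sim similar_mat_trans unfolding jordan_nf_def by blast
  ultimately have "mset as = mset (map (apsnd uminus) as)" using jordan_nf_mset_unique by blast
  moreover have "count (mset (map (apsnd uminus) as)) (k, - z) = count (mset as) (k, z)"
    by (induction as) (auto simp: apsnd_def map_prod_def split: prod.splits)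
  ultimately show ?thesis by metis
qed

text \<open>The multiset of blocks of \<open>Phi X\<close> is invariant under \<open>z \<mapsto> -z\<close> and under conjugation. A block of \<open>X\<close> with
\<open>Im z > 0\<close> appears in it once as \<open>z\<close> and once as \<open>cnj(z)\<close>, and a block with \<open>z\<close> real twice; no block of \<open>X\<close> has
\<open>Im z < 0\<close>. So the symmetry can be read off in each half plane separately.\<close>

lemma count_blocks_reflected:
  assumes X: "X \<in> carrier_mat n n" and sim: "similar_mat (- X) X" and bs: "quat_jordan_form X bs"
  shows "count (mset bs) (k, - cnj z) = count (mset bs) (k, z)"
proof -
  note as = quat_jordan_form_Phi[OF bs]
  have "similar_mat (- Phi X) (Phi X)" using similar_mat_Phi[OF sim] by (simp add: Phi_uminus)
  from count_neg_if_similar_uminus[OF as this, of k "cnj z"]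
  have eq: "count (mset bs) (k, - cnj z) + count (mset bs) (k, - z)
      = count (mset bs) (k, cnj z) + count (mset bs) (k, z)"
    unfolding count_quat_jordan_form[OF bs as] by simp
  consider "Im z > 0" | "Im z < 0" | "Im z = 0" by linarith
  then show ?thesis
  proof cases
    case 1
    then show ?thesis using eq count_eq_0_if_Im_neg[OF bs, of "- z" k] count_eq_0_if_Im_neg[OF bs, of "cnj z" k]
      by simp
  next
    case 2
    then show ?thesis using count_eq_0_if_Im_neg[OF bs, of "- cnj z" k] count_eq_0_if_Im_neg[OF bs, of z k]
      by (simp del: count_mset_0_iff)
  next
    case 3
    then have "cnj z = z" by (simp add: complex_eq_iff)
    then show ?thesis using eq by simp
  qed
qed

section \<open>Construction of an anticommuting involution\<close>

lemma four_block_diag_mult: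
  fixes A B A' B' :: "'a :: semiring_0 mat"
  assumes "A \<in> carrier_mat a a" "A' \<in> carrier_mat a a" "B \<in> carrier_mat b b" "B' \<in> carrier_mat b b"
  shows "four_block_mat A (0\<^sub>m a b) (0\<^sub>m b a) B * four_block_mat A' (0\<^sub>m a b) (0\<^sub>m b a) B'
     = four_block_mat (A * A') (0\<^sub>m a b) (0\<^sub>m b a) (B * B')"
  using assms by (subst mult_four_block_mat[of _ a a _ b _ b _ _ a _ b]) (auto intro!: cong_four_block_mat)

text \<open>The involution is required to be real because then \<open>det (Phi g) = (det g)\<^sup>2\<close>, which is how membership in
\<open>SL\<close> is obtained.\<close>

definition anticomm_involution :: "nat \<Rightarrow> complex mat \<Rightarrow> complex mat \<Rightarrow> bool" where
  "anticomm_involution n g A \<longleftrightarrow> g \<in> carrier_mat n n \<and> A \<in> carrier_mat n n \<and>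
     g * g = 1\<^sub>m n \<and> g * A = - (A * g) \<and> map_mat cnj g = g"

lemma anticomm_involution_four_block:
  assumes "anticomm_involution a g A" "anticomm_involution b h B"
  shows "anticomm_involution (a + b) (four_block_mat g (0\<^sub>m a b) (0\<^sub>m b a) h)
     (four_block_mat A (0\<^sub>m a b) (0\<^sub>m b a) B)"
proof -
  have c: "g \<in> carrier_mat a a" "A \<in> carrier_mat a a" "h \<in> carrier_mat b b" "B \<in> carrier_mat b b"
    and e: "g * g = 1\<^sub>m a" "h * h = 1\<^sub>m b" "g * A = - (A * g)" "h * B = - (B * h)"
      "map_mat cnj g = g" "map_mat cnj h = h"
    using assms unfolding anticomm_involution_def by auto
  have "- four_block_mat (A * g) (0\<^sub>m a b) (0\<^sub>m b a) (B * h)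
      = four_block_mat (- (A * g)) (0\<^sub>m a b) (0\<^sub>m b a) (- (B * h))"
    using c by (intro eq_matI) auto
  moreover have "map_mat cnj (four_block_mat g (0\<^sub>m a b) (0\<^sub>m b a) h)
     = four_block_mat (map_mat cnj g) (0\<^sub>m a b) (0\<^sub>m b a) (map_mat cnj h)"
    using c by (intro eq_matI) auto
  ultimately show ?thesis
    unfolding anticomm_involution_def using c
    by (simp add: four_block_diag_mult e)
qed

lemma anticomm_involution_swap:
  assumes A: "A \<in> carrier_mat a a"
  shows "anticomm_involution (a + a) (four_block_mat (0\<^sub>m a a) (1\<^sub>m a) (1\<^sub>m a) (0\<^sub>m a a))
     (four_block_mat A (0\<^sub>m a a) (0\<^sub>m a a) (- A))"
proof -
  let ?g = "four_block_mat (0\<^sub>m a a) (1\<^sub>m a) (1\<^sub>m a) (0\<^sub>m a a) :: complex mat"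
  let ?D = "four_block_mat A (0\<^sub>m a a) (0\<^sub>m a a) (- A)"
  have "?g * ?g = 1\<^sub>m (a + a)"
    unfolding four_block_one_mat[symmetric, of a a]
    by (subst mult_four_block_mat[of _ a a _ a _ a _ _ a _ a]) (auto intro!: cong_four_block_mat)
  moreover have "?g * ?D = four_block_mat (0\<^sub>m a a) (- A) A (0\<^sub>m a a)"
    using A by (subst mult_four_block_mat[of _ a a _ a _ a _ _ a _ a]) (auto intro!: cong_four_block_mat)
  moreover have "?D * ?g = four_block_mat (0\<^sub>m a a) A (- A) (0\<^sub>m a a)"
    using A by (subst mult_four_block_mat[of _ a a _ a _ a _ _ a _ a]) (auto intro!: cong_four_block_mat)
  moreover have "four_block_mat (0\<^sub>m a a) (- A) A (0\<^sub>m a a) = - four_block_mat (0\<^sub>m a a) A (- A) (0\<^sub>m a a)"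
    using A by (intro eq_matI) auto
  moreover have "map_mat cnj ?g = ?g" by (intro eq_matI) auto
  ultimately show ?thesis unfolding anticomm_involution_def using A by simp
qed

lemma nilpotent_jordan_matrix_entry:
  assumes "\<forall>x\<in>set ns. snd x = (0 :: 'a :: zero_neq_one)" "i < sum_list (map fst ns)" "j < sum_list (map fst ns)"
    "j \<noteq> Suc i"
  shows "jordan_matrix ns $$ (i, j) = 0"
  using assms
proof (induction ns arbitrary: i j)
  case (Cons x ns)
  obtain m where x: "x = (m, 0)" using Cons.prems(1) by (cases x) auto
  show ?case
    unfolding x jordan_matrix_Cons using Cons x by auto
qed simp

text \<open>All non-zero entries of a nilpotent Jordan matrix lie on the superdiagonal, where conjugation by
\<open>diag(1, -1, 1, ...)\<close> changes the sign.\<close>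

lemma anticomm_involution_nilpotent_jordan_matrix:
  assumes "\<forall>x\<in>set ns. snd x = 0"
  shows "anticomm_involution (sum_list (map fst ns))
    (mat_diag (sum_list (map fst ns)) (\<lambda>i. (- 1) ^ i)) (jordan_matrix ns)"
proof -
  let ?b = "sum_list (map fst ns)" and ?J = "jordan_matrix ns :: complex mat"
  have J: "?J \<in> carrier_mat ?b ?b" by (rule jordan_matrix_carrier)
  have "mat_diag ?b (\<lambda>i. (- 1) ^ i) * ?J = - (?J * mat_diag ?b (\<lambda>i. (- 1) ^ i))"
    unfolding mat_diag_mult_left[OF J] mat_diag_mult_right[OF J]
  proof (rule eq_matI, goal_cases)
    case (1 i j)
    then show ?case using nilpotent_jordan_matrix_entry[OF assms, of i j] by (cases "j = Suc i") auto
  qed auto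
  moreover have "(\<lambda>i. (- 1 :: complex) ^ i * (- 1) ^ i) = (\<lambda>i. 1)"
    by (simp add: fun_eq_iff flip: power_mult_distrib)
  moreover have "map_mat cnj (mat_diag ?b (\<lambda>i. (- 1) ^ i)) = mat_diag ?b (\<lambda>i. (- 1) ^ i)"
    by (intro eq_matI) (auto simp: mat_diag_def)
  ultimately show ?thesis unfolding anticomm_involution_def using J by simp
qed

text \<open>The involution is conjugated along with \<open>Y\<close>, which changes neither its square nor \<open>det (Phi g)\<close>.\<close>

lemma strongly_Ad_real_if_similar:
  assumes X: "X \<in> carrier_mat n n" and inv: "anticomm_involution n g Y"
    and sim: "similar_mat X (map_mat quat_of_complex Y)"
  shows "strongly_Ad_real (SL_quat n) X"
proof -
  have g: "g \<in> carrier_mat n n" and Y: "Y \<in> carrier_mat n n" and gg: "g * g = 1\<^sub>m n"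
    and gY: "g * Y = - (Y * g)" and cg: "map_mat cnj g = g"
    using inv unfolding anticomm_involution_def by auto
  define h Z where "h = map_mat quat_of_complex g" and "Z = map_mat quat_of_complex Y"
  have h: "h \<in> carrier_mat n n" and Z: "Z \<in> carrier_mat n n" using g Y by (auto simp: h_def Z_def)
  have hh: "h * h = 1\<^sub>m n"
    unfolding h_def using quat_of_complex.mat_hom_mult[OF g g] gg by (simp add: quat_of_complex.mat_hom_one)
  have um: "map_mat quat_of_complex (- W) = - map_mat quat_of_complex W" for W
    by (intro eq_matI) (auto simp: quat_of_complex_def quat_eq_iff)
  have hZ: "h * Z = - (Z * h)"
    unfolding h_def Z_def quat_of_complex.mat_hom_mult[OF g Y, symmetric]
      quat_of_complex.mat_hom_mult[OF Y g, symmetric] gY um ..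
  obtain P Q where "similar_mat_wit X Z P Q" using sim unfolding similar_mat_def Z_def by blast
  note w = similar_mat_witD2[OF X this]
  have P: "P \<in> carrier_mat n n" and Q: "Q \<in> carrier_mat n n" and PQ: "P * Q = 1\<^sub>m n" "Q * P = 1\<^sub>m n"
    and XE: "X = P * Z * Q" using w by auto
  note assoc = assoc_mult_mat[of _ n n _ n _ n]
  have QP': "Q * (P * W) = W" if "W \<in> carrier_mat n n" for W
    using P Q PQ that by (simp flip: assoc)
  define k where "k = P * h * Q"
  have k: "k \<in> carrier_mat n n" unfolding k_def using P h Q by simp
  have hh': "h * (h * W) = W" if "W \<in> carrier_mat n n" for W
    using h hh that by (simp flip: assoc)
  have kk: "k * k = 1\<^sub>m n"
    unfolding k_def using P Q h by (simp add: assoc QP' hh' PQ)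
  have "k * X * k = P * ((h * Z) * (h * Q))"
    unfolding k_def XE using P Q h Z by (simp add: assoc QP')
  also have "\<dots> = - (P * (Z * Q))"
    unfolding hZ using P Q h Z by (simp add: assoc hh')
  finally have kXk: "- X = k * X * k" unfolding XE using P Q Z by (simp add: assoc)
  have detg: "det (Phi h) = 1"
  proof -
    have "det (Phi h) = det g * det (map_mat cnj g)"
      unfolding h_def Phi_quat_of_complex[OF g]
      using det_four_block_mat_lower_left_zero[of g n "0\<^sub>m n n" n "0\<^sub>m n n" "map_mat cnj g"] g by auto
    then show ?thesis unfolding cg using det_mult[OF g g] gg by simp
  qed
  have "det (Phi P) * det (Phi Q) = 1"
    unfolding det_mult[OF Phi_carrier[OF P] Phi_carrier[OF Q], symmetric] Phi_mult[OF P Q, symmetric] PQ Phi_one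
    by simp
  moreover have "det (Phi k) = det (Phi P) * det (Phi h) * det (Phi Q)"
    unfolding k_def Phi_mult[OF mult_carrier_mat[OF P h] Q] Phi_mult[OF P h]
      det_mult[OF mult_carrier_mat[OF Phi_carrier[OF P] Phi_carrier[OF h]] Phi_carrier[OF Q]]
      det_mult[OF Phi_carrier[OF P] Phi_carrier[OF h]] ..
  ultimately have detk: "det (Phi k) = 1" using detg by simp
  have "inverts_mat k k" unfolding inverts_mat_def using k kk by auto
  then have "invertible_mat k" and neg: "Ad_neg k X"
    unfolding invertible_mat_def Ad_neg_def using k kXk by auto
  then have "k \<in> SL_quat n" unfolding SL_quat_def GL_quat_def using k detk by simp
  then show ?thesis unfolding strongly_Ad_real_def using neg kk k by auto
qed

text \<open>Halving the blocks with non-zero eigenvalue along \<open>(k, z) \<mapsto> (k, -cnj(z))\<close> gives the list \<open>cs\<close>, and \<open>ns\<close> lists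
the nilpotent blocks. With \<open>A\<close> and \<open>N\<close> the Jordan matrices of \<open>cs\<close> and \<open>ns\<close>, the complex matrix
\<open>Y = diag(A, -A, N)\<close> satisfies \<open>Phi Y = diag(Y, cnj(Y))\<close>, whose blocks are those of \<open>Phi X\<close>: the reflection
\<open>-cnj(z)\<close> differs from \<open>-z\<close> by the conjugation that relates the two halves of \<open>Phi Y\<close>.\<close>

lemma strongly_Ad_real_if_even_blocks:
  assumes X: "X \<in> carrier_mat n n" and sim: "similar_mat (- X) X" and bs: "quat_jordan_form X bs"
    and even: "\<And>k z. Re z = 0 \<Longrightarrow> z \<noteq> 0 \<Longrightarrow> even (count (mset bs) (k, z))"
  shows "strongly_Ad_real (SL_quat n) X"
proof -
  define \<sigma> :: "nat \<times> complex \<Rightarrow> nat \<times> complex" where "\<sigma> = apsnd (\<lambda>z. - cnj z)"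
  define M where "M = filter_mset (\<lambda>x. snd x \<noteq> 0) (mset bs)"
  obtain ns where ns: "mset ns = filter_mset (\<lambda>x. snd x = 0) (mset bs)" using ex_mset by blast
  have part: "mset bs = M + mset ns"
    unfolding M_def ns by (rule multiset_eqI) simp
  have "\<exists>H. M = H + image_mset \<sigma> H"
  proof (rule multiset_halve_by_involution)
    show "\<sigma> (\<sigma> x) = x" for x by (cases x) (simp add: \<sigma>_def)
    show "count M (\<sigma> x) = count M x" for x
      using count_blocks_reflected[OF X sim bs, of "fst x" "snd x"]
      by (cases x) (auto simp: \<sigma>_def M_def)
    show "even (count M x)" if "\<sigma> x = x" for x
    proof -
      obtain k z where x: "x = (k, z)" by fastforce
      have "Re z = 0" using that by (simp add: x \<sigma>_def complex_eq_iff)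
      then show ?thesis using even[of z k] by (auto simp: x M_def)
    qed
  qed
  then obtain H where H: "M = H + image_mset \<sigma> H" by blast
  obtain cs where cs: "mset cs = H" using ex_mset by blast
  have bs_mset: "mset bs = mset cs + image_mset \<sigma> (mset cs) + mset ns" using part H cs by simp
  have nz: "0 \<notin> fst ` set bs" using quat_jordan_form_Phi[OF bs] unfolding jordan_nf_def by auto
  have "set bs = set cs \<union> \<sigma> ` set cs \<union> set ns"
    using arg_cong[OF bs_mset, of set_mset] by simp
  then have nzc: "0 \<notin> fst ` set cs" and nzn: "0 \<notin> fst ` set ns" using nz by auto
  have ns0: "\<forall>x\<in>set ns. snd x = 0"
    using ns by (metis (mono_tags, lifting) mem_Collect_eq set_mset_filter set_mset_mset)
  define a b where "a = sum_list (map fst cs)" and "b = sum_list (map fst ns)"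
  define A N where "A = (jordan_matrix cs :: complex mat)" and "N = (jordan_matrix ns :: complex mat)"
  have A: "A \<in> carrier_mat a a" and N: "N \<in> carrier_mat b b"
    unfolding A_def a_def N_def b_def by (rule jordan_matrix_carrier)+
  define D where "D = four_block_mat A (0\<^sub>m a a) (0\<^sub>m a a) (- A)"
  have D: "D \<in> carrier_mat (a + a) (a + a)" unfolding D_def using A by simp
  define Y where "Y = four_block_mat D (0\<^sub>m (a + a) b) (0\<^sub>m b (a + a)) N"
  obtain g where g: "anticomm_involution (a + a + b) g Y"
    using anticomm_involution_four_block[OF anticomm_involution_swap[OF A]
        anticomm_involution_nilpotent_jordan_matrix[OF ns0, folded b_def N_def]]
    unfolding Y_def D_def by blast
  have Y: "Y \<in> carrier_mat (a + a + b) (a + a + b)" unfolding Y_def using D N by simp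
  have nA: "jordan_nf A cs" unfolding A_def by (rule jordan_nf_jordan_matrix[OF nzc])
  have "(- 1) \<cdot>\<^sub>m A = - A" by (intro eq_matI) auto
  then have nA': "jordan_nf (- A) (map (apsnd uminus) cs)"
    using jordan_nf_smult[OF nA, of "- 1"] by (simp add: apsnd_def map_prod_def)
  have nN: "jordan_nf N ns" unfolding N_def by (rule jordan_nf_jordan_matrix[OF nzn])
  define ys where "ys = (cs @ map (apsnd uminus) cs) @ ns"
  have nY: "jordan_nf Y ys"
    unfolding Y_def D_def ys_def
    by (intro jordan_nf_four_block nA nA' nN) (use A N in auto)
  have PY: "jordan_nf (Phi (map_mat quat_of_complex Y)) (ys @ map (apsnd cnj) ys)"
    unfolding Phi_quat_of_complex[OF Y] by (intro jordan_nf_four_block nY jordan_nf_cnj) (use Y in auto)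
  have "mset (bs @ map (apsnd cnj) bs) = mset (ys @ map (apsnd cnj) ys)"
  proof -
    have "apsnd cnj \<circ> \<sigma> = apsnd uminus" "apsnd cnj \<circ> apsnd uminus = \<sigma>"
      by (auto simp: \<sigma>_def fun_eq_iff)
    then show ?thesis by (simp add: bs_mset ys_def multiset.map_comp)
  qed
  from similar_mat_if_jordan_nf_mset[OF quat_jordan_form_Phi[OF bs] PY this]
  have simP: "similar_mat (Phi X) (Phi (map_mat quat_of_complex Y))" .
  have n: "a + a + b = n"
  proof -
    obtain m where m: "Phi X \<in> carrier_mat m m" "Phi (map_mat quat_of_complex Y) \<in> carrier_mat m m"
      using similar_matD[OF simP] by blast
    from carrier_matD(1)[OF m(1)] carrier_matD(1)[OF m(2)] show ?thesis
      using carrier_matD(1)[OF X] carrier_matD(1)[OF Y] by simp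
  qed
  have "similar_mat X (map_mat quat_of_complex Y)"
    by (rule similar_mat_if_similar_mat_Phi[OF X _ simP]) (use Y n in simp)
  then show ?thesis using strongly_Ad_real_if_similar[OF X] g unfolding n by blast
qed

section \<open>Characterisation of the strongly Ad-real elements\<close>

lemma Ad_negE:
  assumes "Ad_neg g X" "X \<in> carrier_mat n n" "g \<in> carrier_mat n n"
  obtains h where "h \<in> carrier_mat n n" "g * h = 1\<^sub>m n" "h * g = 1\<^sub>m n" "- X = g * X * h"
proof -
  obtain h where h: "g * h = 1\<^sub>m (dim_row g)" "h * g = 1\<^sub>m (dim_row h)" "- X = g * X * h"
    using assms(1) unfolding Ad_neg_def inverts_mat_def by blast
  have "dim_col h = n" using arg_cong[OF h(1), of dim_col] assms(3) by simp
  moreover have "dim_row h = n" using arg_cong[OF h(2), of dim_col] assms(3) by simp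
  ultimately show ?thesis using that[of h] h assms(3) by auto
qed

theorem theorem1p3:
  fixes n :: nat and X :: "quat mat"
  assumes "X \<in> sl_quat n" and "X \<noteq> 0\<^sub>m n n" and "Ad_real (SL_quat n) X"
  shows "strongly_Ad_real (SL_quat n) X \<longleftrightarrow>
    (\<forall>\<mu> \<in> eigenvalue_reps X. \<mu> \<noteq> 0 \<and> Re \<mu> = 0 \<longrightarrow>
      (\<forall>d. d \<in># eigen_partition X \<mu> \<longrightarrow> even (count (eigen_partition X \<mu>) d)))"
proof -
  have X: "X \<in> carrier_mat n n" using assms(1) by (simp add: sl_quat_def)
  obtain bs where bs: "quat_jordan_form X bs" and blocks: "jordan_blocks X = mset bs"
    using jordan_blocks_quat_jordan_form[OF X] by blast
  note cnt = count_eigen_partition[OF blocks]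
  have SLc: "g \<in> carrier_mat n n" if "g \<in> SL_quat n" for g
    using that by (simp add: SL_quat_def GL_quat_def)
  show ?thesis
  proof
    assume "strongly_Ad_real (SL_quat n) X"
    then obtain g where g: "g \<in> carrier_mat n n" and gg: "g * g = 1\<^sub>m n" and neg: "Ad_neg g X"
      unfolding strongly_Ad_real_def using SLc by fastforce
    obtain h where h: "h \<in> carrier_mat n n" "h * g = 1\<^sub>m n" "- X = g * X * h"
      using Ad_negE[OF neg X g] by blast
    have "- (X * g) = g * X * h * g" unfolding h(3)[symmetric] using X g by simp
    also have "\<dots> = g * X * (h * g)" by (rule assoc_mult_mat[OF mult_carrier_mat[OF g X] h(1) g])
    also have "\<dots> = g * X" unfolding h(2) using right_mult_one_mat[OF mult_carrier_mat[OF g X]] .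
    finally have Xg: "X * g = - (g * X)" by (metis uminus_uminus_mat)
    show "\<forall>\<mu> \<in> eigenvalue_reps X. \<mu> \<noteq> 0 \<and> Re \<mu> = 0 \<longrightarrow>
      (\<forall>d. d \<in># eigen_partition X \<mu> \<longrightarrow> even (count (eigen_partition X \<mu>) d))"
    proof (intro ballI impI allI)
      fix \<mu> d assume "\<mu> \<in> eigenvalue_reps X" "\<mu> \<noteq> 0 \<and> Re \<mu> = 0"
      then have "Re \<mu> = 0" "Im \<mu> > 0"
        by (auto simp: eigenvalue_reps_def complex_eq_iff)
      from even_blocks_if_anticommuting_involution[OF X g gg Xg bs this]
      show "even (count (eigen_partition X \<mu>) d)" unfolding cnt .
    qed
  next
    assume even: "\<forall>\<mu> \<in> eigenvalue_reps X. \<mu> \<noteq> 0 \<and> Re \<mu> = 0 \<longrightarrow>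
      (\<forall>d. d \<in># eigen_partition X \<mu> \<longrightarrow> even (count (eigen_partition X \<mu>) d))"
    obtain g where g: "g \<in> carrier_mat n n" and neg: "Ad_neg g X"
      using assms(3) SLc unfolding Ad_real_def by blast
    obtain h where h: "h \<in> carrier_mat n n" "g * h = 1\<^sub>m n" "h * g = 1\<^sub>m n" "- X = g * X * h"
      using Ad_negE[OF neg X g] by blast
    have "similar_mat (- X) X" by (rule similar_matI[OF _ h(2-4)]) (use X g h(1) in auto)
    then show "strongly_Ad_real (SL_quat n) X"
    proof (rule strongly_Ad_real_if_even_blocks[OF X _ bs])
      fix k z assume z: "Re z = 0" "z \<noteq> (0 :: complex)"
      show "even (count (mset bs) (k, z))"
      proof (cases "(k, z) \<in> set bs")
        case True
        then have "z \<in> eigenvalue_reps X" by (rule block_eigenvalue_rep[OF X bs])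
        moreover have "k \<in># eigen_partition X z"
          using count_mset_gt_0[OF True] unfolding cnt[symmetric] by simp
        ultimately show ?thesis using even z unfolding cnt[symmetric] by blast
      next
        case False
        then have "count (mset bs) (k, z) = 0" by simp
        then show ?thesis by (simp del: count_mset_0_iff)
      qed
    qed
  qed
qed

end
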